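(* For every $h\in(1,2)$ there exist a uniformly continuous, weakly divergence-free velocity field $W:[0,1]\times\mathbb{R}^2\to\mathbb{R}^2$ and a compact set $S\subset\mathbb{R}^2$ with $\dim_H S=h$ such that $W$ admits a unique trajectory map $X_W:[0,1]\times\mathbb{R}^2\to\mathbb{R}^2$, and this trajectory map satisfies $\dim_H X_W(t,S)=h$ for all $t\in[0,1)$ and $X_W(1,S)=\{0\}$.
   Context: Trajectory map: Given $U\in C([0,T]\times\mathbb{R}^d;\mathbb{R}^d)$ and $A\subset\mathbb{R}^d$, a map $X_U:[0,T]\times A\to\mathbb{R}^d$ is a trajectory map for $U$ on $A$ if for every $a\in A$ the map $t\mapsto X_U(t,a)$ is differentiable at all $t\in[0,T]$ and $\partial_tX_U(t,a)=U(t,X_U(t,a))$, $X_U(0,a)=a$. When $A$ is not specified, $A=\mathbb{R}^d$. Uniqueness means every such trajectory is uniquely determined by its initial point. $\dim_H$ denotes Hausdorff dimension. *)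

theory Defs
  imports "HOL-Analysis.Analysis"
begin

coinductive smooth_fun :: "('a::real_normed_vector \<Rightarrow> real) \<Rightarrow> bool" where
  "f differentiable_on UNIV \<Longrightarrow> (\<forall>v. smooth_fun (\<lambda>x. frechet_derivative f (at x) v))
     \<Longrightarrow> smooth_fun f"

definition test_fun :: "(real \<times> (real^2) \<Rightarrow> real) \<Rightarrow> bool" where
  "test_fun \<phi> \<longleftrightarrow> smooth_fun \<phi> \<and> compact (closure {z. \<phi> z \<noteq> 0})
      \<and> closure {z. \<phi> z \<noteq> 0} \<subseteq> {0<..<1} \<times> UNIV"

text \<open>Weakly divergence-free on [0,1] x R^2: for every test function phi,
  the integral of W(t,x) . grad_x phi(t,x) over space-time vanishes.
  Note W . grad_x phi (t,x) = D phi(t,x) applied to the direction (0, W t x).\<close>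
definition weakly_div_free :: "(real \<Rightarrow> real^2 \<Rightarrow> real^2) \<Rightarrow> bool" where
  "weakly_div_free W \<longleftrightarrow> (\<forall>\<phi>. test_fun \<phi> \<longrightarrow>
      (\<integral>z. frechet_derivative \<phi> (at z) (0, W (fst z) (snd z)) \<partial>lborel) = 0)"

definition trajectory_map ::
  "real \<Rightarrow> (real \<Rightarrow> 'a::euclidean_space \<Rightarrow> 'a) \<Rightarrow> 'a set \<Rightarrow> (real \<Rightarrow> 'a \<Rightarrow> 'a) \<Rightarrow> bool" where
  "trajectory_map T U A X \<longleftrightarrow> (\<forall>a\<in>A. X 0 a = a \<and>
      (\<forall>t\<in>{0..T}. ((\<lambda>s. X s a) has_vector_derivative U t (X t a)) (at t within {0..T})))"

definition hausdorff_pre :: "real \<Rightarrow> real \<Rightarrow> 'a::metric_space set \<Rightarrow> ennreal" where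
  "hausdorff_pre s \<delta> A = (INF C\<in>{C::nat \<Rightarrow> 'a set. A \<subseteq> (\<Union>i. C i) \<and>
       (\<forall>i. bounded (C i) \<and> diameter (C i) \<le> \<delta>)}. (\<Sum>i. ennreal (diameter (C i) powr s)))"

definition hausdorff_measure :: "real \<Rightarrow> 'a::metric_space set \<Rightarrow> ennreal" where
  "hausdorff_measure s A = (SUP \<delta>\<in>{0<..}. hausdorff_pre s \<delta> A)"

definition hausdorff_dim :: "'a::metric_space set \<Rightarrow> ereal" where
  "hausdorff_dim A = (INF s\<in>{s::real. 0 \<le> s \<and> hausdorff_measure s A = 0}. ereal s)"

end

theory Submission
  imports Defs
begin

text \<open>
  Let \<open>S\<close> be the planar Cantor set of all \<open>(\<Sum>k. a k * r ^ k, \<Sum>k. b k * r ^ k)\<close> with binary digits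
  \<open>a\<close>, \<open>b\<close> and \<open>4 * r powr h = 1\<close>. The field is a sequence of shears, alternately vertical and
  horizontal, each run in its own time slot. Shears are divergence-free, their flow is explicit,
  and a trajectory keeps the coordinate on which the current shear depends; this gives existence and
  uniqueness slot by slot, and the flow is bi-Lipschitz before time 1, so it preserves dimensions.

  The shears gradually replace the digit weights \<open>r ^ k\<close> by smaller ones. For \<open>2 < q < 1 / r\<close>,
  weights that decrease at least by the factor \<open>q\<close> let every digit be read off from the sum in a Lipschitz
  way, so four shears, each of size proportional to the current diameter, multiply a single weight
  by \<open>q * r < 1\<close>. Stage \<open>n\<close> treats the digits \<open>0, \<dots>, n\<close>; it consists of \<open>O(n)\<close> shears while the diameter
  decays like \<open>(q * r) ^ n\<close>. Hence the slots can be chosen so that the speeds tend to 0 at time 1, and \<open>S\<close> ends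
  up in one point.
\<close>

section \<open>Shift-invariant fields\<close>

text \<open>\<open>w\<close> is merely continuous, so the derivative cannot be moved onto it.
  Instead the derivative is a limit of difference quotients of \<open>\<phi>\<close>. As
  \<open>w\<close> is constant along \<open>v\<close>, translation invariance of Lebesgue measure
  makes each weighted quotient integrate to 0, and dominated convergence passes to the
  limit.\<close>

lemma integral_shift_invariant_deriv_eq_0:
  fixes \<phi> :: "'a::euclidean_space \<Rightarrow> real"
  assumes diff: "\<phi> differentiable_on UNIV"
    and cont: "continuous_on UNIV (\<lambda>z. frechet_derivative \<phi> (at z) v)"
    and cpt: "compact (closure {z. \<phi> z \<noteq> 0})"
    and w: "continuous_on UNIV w"
    and inv: "\<And>z s. w (z + s *\<^sub>R v) = w z"
  shows "integrable lborel (\<lambda>z. w z * frechet_derivative \<phi> (at z) v)"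
    and "(\<integral>z. w z * frechet_derivative \<phi> (at z) v \<partial>lborel) = 0"
proof -
  define K where "K = closure {z. \<phi> z \<noteq> 0}"
  define D where "D z = frechet_derivative \<phi> (at z) v" for z
  \<comment> \<open>Sweeping the support back along \<open>v\<close> for times up to 1 covers the
    supports of all difference quotients with step \<open>1 / Suc n\<close>.\<close>
  define K' where "K' = (\<lambda>(x, s). x - s *\<^sub>R v) ` (K \<times> {0..1::real})"
  have cK: "compact K" using cpt by (simp add: K_def)
  have cK': "compact K'"
    unfolding K'_def case_prod_unfold
    by (intro compact_continuous_image continuous_intros compact_Times cK compact_Icc)
  have KK': "K \<subseteq> K'"
  proof
    fix x assume "x \<in> K"
    then show "x \<in> K'" unfolding K'_def by (intro image_eqI[of _ _ "(x, 0)"]) simp_all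
  qed
  have zero: "\<phi> z = 0" if "z \<notin> K" for z
    using that closure_subset[of "{z. \<phi> z \<noteq> 0}"] unfolding K_def by blast
  have hd: "(\<phi> has_derivative frechet_derivative \<phi> (at z)) (at z)" for z
    using diff frechet_derivative_works unfolding differentiable_on_def by blast
  have cphi: "continuous_on UNIV \<phi>"
    using diff differentiable_imp_continuous_on by blast
  have line: "((\<lambda>t. \<phi> (z + t *\<^sub>R v)) has_real_derivative D (z + t *\<^sub>R v)) (at t)" for z t
  proof -
    have "((\<lambda>t. z + t *\<^sub>R v) has_derivative (\<lambda>h. h *\<^sub>R v)) (at t)"
      by (auto intro!: derivative_eq_intros)
    from has_derivative_compose[OF this hd]
    have "((\<lambda>t. \<phi> (z + t *\<^sub>R v)) has_derivative (\<lambda>h. frechet_derivative \<phi> (at (z + t *\<^sub>R v)) (h *\<^sub>R v))) (at t)" .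
    moreover have "frechet_derivative \<phi> (at (z + t *\<^sub>R v)) (h *\<^sub>R v) = D (z + t *\<^sub>R v) * h" for h
      unfolding D_def using linear_scale[OF has_derivative_linear[OF hd]] by simp
    ultimately show ?thesis by (simp add: has_field_derivative_def)
  qed
  have Dzero: "D z = 0" if "z \<notin> K" for z
  proof -
    have "((\<lambda>_. 0) has_derivative frechet_derivative \<phi> (at z)) (at z)"
    proof (rule has_derivative_transform_within_open[OF hd])
      show "open (- K)" using cK by (simp add: compact_imp_closed open_Compl)
    qed (use that zero in auto)
    then have "frechet_derivative \<phi> (at z) = (\<lambda>_. 0)"
      by (metis has_derivative_const has_derivative_unique)
    then show ?thesis by (simp add: D_def)
  qed
  obtain B where B: "\<And>z. z \<in> K' \<Longrightarrow> \<bar>w z\<bar> \<le> B"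
    using compact_imp_bounded[OF compact_continuous_image[OF continuous_on_subset[OF w] cK']]
    by (auto simp: bounded_iff)
  obtain E0 where "\<And>z. z \<in> K \<Longrightarrow> \<bar>D z\<bar> \<le> E0"
    using compact_imp_bounded[OF compact_continuous_image[OF continuous_on_subset[OF cont] cK]]
    by (auto simp: bounded_iff D_def)
  then obtain E where E: "\<And>z. \<bar>D z\<bar> \<le> E"
    using Dzero by (metis abs_zero max.cobounded1 max.cobounded2 order_trans)
  define g where "g n z = w z * ((\<phi> (z + (1 / Suc n) *\<^sub>R v) - \<phi> z) / (1 / Suc n))" for n :: nat and z
  have bound: "norm (g n z) \<le> indicator K' z * (B * E)" for n z
  proof (cases "z \<in> K'")
    case True
    \<comment> \<open>The mean value theorem turns the quotient into a value of \<open>D\<close>,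
      which is bounded by \<open>E\<close> uniformly in \<open>n\<close>.\<close>
    have "\<exists>t. 0 < t \<and> t < 1 / Suc n \<and> \<phi> (z + (1 / Suc n) *\<^sub>R v) - \<phi> (z + 0 *\<^sub>R v) = (1 / Suc n - 0) * D (z + t *\<^sub>R v)"
      by (rule MVT2) (use line in auto)
    then obtain t where "(\<phi> (z + (1 / Suc n) *\<^sub>R v) - \<phi> z) / (1 / Suc n) = D (z + t *\<^sub>R v)"
      by auto
    then show ?thesis
      using True B[OF True] E[of "z + t *\<^sub>R v"] by (auto simp: g_def abs_mult intro!: mult_mono)
  next
    case False
    then have "z \<notin> K" using KK' by auto
    moreover have "z + (1 / Suc n) *\<^sub>R v \<notin> K"
    proof
      assume "z + (1 / Suc n) *\<^sub>R v \<in> K"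
      then have "z \<in> K'"
        unfolding K'_def by (intro image_eqI[of _ _ "(z + (1 / Suc n) *\<^sub>R v, 1 / Suc n)"]) auto
      then show False using False by simp
    qed
    ultimately show ?thesis using zero False by (simp add: g_def)
  qed
  have lim: "(\<lambda>n. g n z) \<longlonglongrightarrow> w z * D z" for z
  proof -
    have "((\<lambda>h. (\<phi> (z + (0 + h) *\<^sub>R v) - \<phi> (z + 0 *\<^sub>R v)) / h) \<longlongrightarrow> D (z + 0 *\<^sub>R v)) (at 0)"
      using line[of z 0] unfolding DERIV_def .
    moreover have "filterlim (\<lambda>n. 1 / real (Suc n)) (at 0) sequentially"
      unfolding filterlim_at using LIMSEQ_inverse_real_of_nat
      by (auto simp: inverse_eq_divide)
    ultimately have "((\<lambda>n. (\<phi> (z + (0 + 1 / real (Suc n)) *\<^sub>R v) - \<phi> (z + 0 *\<^sub>R v)) / (1 / real (Suc n))) \<longlongrightarrow> D (z + 0 *\<^sub>R v)) sequentially"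
      by (rule filterlim_compose)
    then show ?thesis unfolding g_def by (intro tendsto_mult) auto
  qed
  have int: "integrable lborel (\<lambda>z. w z * \<phi> z)"
  proof -
    have "integrable lborel (\<lambda>z. indicator K z *\<^sub>R (w z * \<phi> z))"
      using cK w cphi
      by (intro borel_integrable_compact continuous_intros) (auto intro: continuous_on_subset)
    also have "(\<lambda>z. indicator K z *\<^sub>R (w z * \<phi> z)) = (\<lambda>z. w z * \<phi> z)"
      using zero by (auto simp: fun_eq_iff indicator_def)
    finally show ?thesis .
  qed
  \<comment> \<open>Invariance of \<open>w\<close> enters here: the integrand becomes a translate of
    \<open>w * \<phi>\<close>.\<close>
  have shift: "(\<lambda>z. w z * \<phi> (z + s *\<^sub>R v)) = (\<lambda>z. w (s *\<^sub>R v + z) * \<phi> (s *\<^sub>R v + z))" for s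
    using inv by (simp add: add.commute)
  have int2: "integrable lborel (\<lambda>z. w z * \<phi> (z + s *\<^sub>R v))" for s
  proof -
    have "integrable (distr lborel borel ((+) (s *\<^sub>R v))) (\<lambda>z. w z * \<phi> z)"
      using int by (subst lborel_distr_plus) 
    then show ?thesis unfolding shift by (subst (asm) integrable_distr_eq) (use int in auto)
  qed
  have eq: "(\<integral>z. w z * \<phi> (z + s *\<^sub>R v) \<partial>lborel) = (\<integral>z. w z * \<phi> z \<partial>lborel)" for s
  proof -
    have "(\<integral>z. w z * \<phi> z \<partial>lborel) = (\<integral>z. w z * \<phi> z \<partial>(distr lborel borel ((+) (s *\<^sub>R v))))"
      by (subst lborel_distr_plus) simp
    also have "\<dots> = (\<integral>z. w z * \<phi> (z + s *\<^sub>R v) \<partial>lborel)"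
      unfolding shift by (subst integral_distr) (use int in auto)
    finally show ?thesis by simp
  qed
  have g_alt: "g n = (\<lambda>z. (w z * \<phi> (z + (1 / Suc n) *\<^sub>R v) - w z * \<phi> z) * real (Suc n))" for n
    by (auto simp: g_def fun_eq_iff field_simps)
  have g0: "(\<integral>z. g n z \<partial>lborel) = 0" for n
    unfolding g_alt using int int2[of "1 / Suc n"] eq[of "1 / Suc n"] by simp
  have gint: "integrable lborel (g n)" for n
    unfolding g_alt using int int2[of "1 / Suc n"] by simp
  have wD: "(\<lambda>z. w z * D z) \<in> borel_measurable lborel"
    using w cont unfolding D_def
    by (auto intro!: borel_measurable_continuous_onI continuous_intros)
  have dom: "integrable lborel (\<lambda>z. indicator K' z * (B * E))"
    using borel_integrable_compact[OF cK', of "\<lambda>_. B * E"] by simp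
  have gm: "g n \<in> borel_measurable lborel" for n using gint by blast
  note dct = integrable_dominated_convergence[of "\<lambda>z. w z * D z" lborel g, OF wD gm dom]
    integral_dominated_convergence[of "\<lambda>z. w z * D z" lborel g, OF wD gm dom]
  show "integrable lborel (\<lambda>z. w z * frechet_derivative \<phi> (at z) v)"
    using dct(1) lim bound by (simp add: D_def)
  have "(\<lambda>n. \<integral>z. g n z \<partial>lborel) \<longlonglongrightarrow> (\<integral>z. w z * D z \<partial>lborel)"
    using dct(2) lim bound by simp
  then show "(\<integral>z. w z * frechet_derivative \<phi> (at z) v \<partial>lborel) = 0"
    by (simp add: g0 D_def LIMSEQ_const_iff)
qed

text \<open>Component \<open>i\<close> of the field does not change along axis \<open>i\<close>, so
  each term of the pairing with the gradient vanishes separately, by the previous lemma with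
  \<open>v = (0, axis i 1)\<close>.\<close>

lemma weakly_div_free_if_shift_invariant:
  assumes cont: "continuous_on UNIV (\<lambda>z. W (fst z) (snd z))"
    and inv: "\<And>t x i s. W t (x + s *\<^sub>R axis i 1) $ i = W t x $ i"
  shows "weakly_div_free W"
  unfolding weakly_div_free_def
proof (intro allI impI)
  fix \<phi> :: "real \<times> (real^2) \<Rightarrow> real"
  assume t: "test_fun \<phi>"
  then have sm: "smooth_fun \<phi>" and cpt: "compact (closure {z. \<phi> z \<noteq> 0})"
    by (auto simp: test_fun_def)
  have diff: "\<phi> differentiable_on UNIV" and sm': "smooth_fun (\<lambda>x. frechet_derivative \<phi> (at x) v)" for v
    using sm by (auto elim: smooth_fun.cases)
  \<comment> \<open>Unfolding the coinductive definition a second time: the directional derivative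
    is itself differentiable, hence continuous.\<close>
  have cont': "continuous_on UNIV (\<lambda>x. frechet_derivative \<phi> (at x) v)" for v
    using sm'[of v] by (auto elim: smooth_fun.cases intro: differentiable_imp_continuous_on)
  let ?e = "\<lambda>i::2. (0::real, axis i (1::real))"
  let ?w = "\<lambda>i z. W (fst z) (snd z) $ i"
  have split: "frechet_derivative \<phi> (at z) (0, W (fst z) (snd z))
      = (\<Sum>i\<in>UNIV. ?w i z * frechet_derivative \<phi> (at z) (?e i))" for z
  proof -
    have lin: "linear (frechet_derivative \<phi> (at z))"
      using diff unfolding differentiable_on_def by (intro linear_frechet_derivative) blast
    have "(0::real, W (fst z) (snd z)) = (\<Sum>i\<in>UNIV. ?w i z *\<^sub>R ?e i)"
      by (auto simp: prod_eq_iff fst_sum snd_sum vec_eq_iff sum.If_cases axis_def if_distrib cong: if_cong)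
    then show ?thesis
      by (simp add: linear_sum[OF lin] linear_scale[OF lin] del: scaleR_Pair)
  qed
  have cw: "continuous_on UNIV (?w i)" for i
    using cont by (intro continuous_intros)
  note key = integral_shift_invariant_deriv_eq_0[OF diff cont' cpt cw]
  show "(\<integral>z. frechet_derivative \<phi> (at z) (0, W (fst z) (snd z)) \<partial>lborel) = 0"
    unfolding split using inv by (subst Bochner_Integration.integral_sum) (auto intro!: key sum.neutral)
qed

section \<open>Flows of successive shears\<close>

lemma uniformly_continuous_on_uniform_limit:
  fixes f :: "nat \<Rightarrow> 'a::metric_space \<Rightarrow> 'b::metric_space"
  assumes f: "\<And>n. uniformly_continuous_on S (f n)"
    and lim: "uniform_limit S f g sequentially"
  shows "uniformly_continuous_on S g"
  unfolding uniformly_continuous_on_def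
proof (intro allI impI)
  fix e :: real assume e: "e > 0"
  then have "\<forall>\<^sub>F n in sequentially. \<forall>x\<in>S. dist (f n x) (g x) < e / 3"
    using uniform_limitD[OF lim, of "e / 3"] by simp
  then obtain n where n: "\<And>x. x \<in> S \<Longrightarrow> dist (f n x) (g x) < e / 3"
    by (auto simp: eventually_sequentially)
  from f[of n] e obtain d where d: "d > 0" "\<And>x y. x \<in> S \<Longrightarrow> y \<in> S \<Longrightarrow> dist y x < d \<Longrightarrow> dist (f n y) (f n x) < e / 3"
    unfolding uniformly_continuous_on_def by (metis divide_pos_pos zero_less_numeral)
  have "dist (g y) (g x) < e" if "x \<in> S" "y \<in> S" "dist y x < d" for x y
    using n[OF that(1)] n[OF that(2)] d(2)[OF that]
      dist_triangle[of "g y" "g x" "f n y"] dist_triangle[of "f n y" "g x" "f n x"]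
    by (simp add: dist_commute)
  then show "\<exists>d>0. \<forall>x\<in>S. \<forall>x'\<in>S. dist x' x < d \<longrightarrow> dist (g x') (g x) < e"
    using d(1) by blast
qed

lemma lipschitz_on_scaleR_bounded:
  fixes g :: "'a::metric_space \<Rightarrow> real" and h :: "'a \<Rightarrow> 'b::real_normed_vector"
  assumes g: "c-lipschitz_on S g" and h: "d-lipschitz_on S h"
    and A: "\<And>x. x \<in> S \<Longrightarrow> \<bar>g x\<bar> \<le> A" and B: "\<And>x. x \<in> S \<Longrightarrow> norm (h x) \<le> B"
    and nonneg: "0 \<le> A" "0 \<le> B"
  shows "(A * d + B * c)-lipschitz_on S (\<lambda>x. g x *\<^sub>R h x)"
proof (rule lipschitz_onI)
  fix x y assume xy: "x \<in> S" "y \<in> S"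
  have "g x *\<^sub>R h x - g y *\<^sub>R h y = g x *\<^sub>R (h x - h y) + (g x - g y) *\<^sub>R h y"
    by (simp add: algebra_simps)
  then have "dist (g x *\<^sub>R h x) (g y *\<^sub>R h y) \<le> \<bar>g x\<bar> * norm (h x - h y) + \<bar>g x - g y\<bar> * norm (h y)"
    by (metis dist_norm norm_scaleR norm_triangle_ineq)
  also have "\<dots> \<le> A * (d * dist x y) + (c * dist x y) * B"
    using lipschitz_onD[OF g xy] lipschitz_onD[OF h xy] A[OF xy(1)] B[OF xy(2)] nonneg
    by (intro add_mono mult_mono) (auto simp: dist_norm intro: mult_nonneg_nonneg lipschitz_on_nonneg[OF g])
  finally show "dist (g x *\<^sub>R h x) (g y *\<^sub>R h y) \<le> (A * d + B * c) * dist x y"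
    by (simp add: algebra_simps)
qed (use lipschitz_on_nonneg[OF g] lipschitz_on_nonneg[OF h] nonneg in simp)

lemma has_vector_derivative_series:
  fixes f :: "nat \<Rightarrow> real \<Rightarrow> 'a::banach"
  assumes f: "\<And>n t. (f n has_vector_derivative f' n t) (at t)"
    and bound: "\<And>n t. norm (f' n t) \<le> M n" and M: "summable M"
    and t0: "summable (\<lambda>n. f n t0)"
  shows "((\<lambda>t. \<Sum>n. f n t) has_vector_derivative (\<Sum>n. f' n t)) (at t)"
proof -
  have lim: "uniform_limit UNIV (\<lambda>n t. \<Sum>i<n. f' i t) (\<lambda>t. \<Sum>n. f' n t) sequentially"
    using bound M by (intro Weierstrass_m_test) auto
  have "\<exists>g. \<forall>t\<in>UNIV. (\<lambda>n. f n t) sums (g t) \<and> (g has_derivative (\<lambda>h. h *\<^sub>R (\<Sum>n. f' n t))) (at t within UNIV)"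
  proof (rule has_derivative_series)
    show "(f n has_derivative (\<lambda>h. h *\<^sub>R f' n t)) (at t within UNIV)" for n t
      using f by (simp add: has_vector_derivative_def)
    fix e :: real assume "e > 0"
    from uniform_limitD[OF lim this]
    show "\<forall>\<^sub>F n in sequentially. \<forall>t\<in>UNIV. \<forall>h. norm ((\<Sum>i<n. h *\<^sub>R f' i t) - h *\<^sub>R (\<Sum>n. f' n t)) \<le> e * norm h"
    proof (rule eventually_mono, intro ballI allI)
      fix n t and h :: real assume *: "\<forall>t\<in>UNIV. dist (\<Sum>i<n. f' i t) (\<Sum>n. f' n t) < e"
      have "(\<Sum>i<n. h *\<^sub>R f' i t) - h *\<^sub>R (\<Sum>n. f' n t) = h *\<^sub>R ((\<Sum>i<n. f' i t) - (\<Sum>n. f' n t))"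
        by (simp add: scaleR_right_diff_distrib scaleR_right.sum)
      then have "norm ((\<Sum>i<n. h *\<^sub>R f' i t) - h *\<^sub>R (\<Sum>n. f' n t)) = \<bar>h\<bar> * norm ((\<Sum>i<n. f' i t) - (\<Sum>n. f' n t))"
        by simp
      also have "\<dots> \<le> \<bar>h\<bar> * e"
        using * by (intro mult_left_mono) (auto simp: dist_norm less_imp_le)
      finally show "norm ((\<Sum>i<n. h *\<^sub>R f' i t) - h *\<^sub>R (\<Sum>n. f' n t)) \<le> e * norm h"
        by (simp add: mult.commute)
    qed
  qed (use t0 in auto)
  then obtain g where g: "\<And>t. (\<lambda>n. f n t) sums g t"
      "\<And>t. (g has_vector_derivative (\<Sum>n. f' n t)) (at t)"
    by (auto simp: has_vector_derivative_def)
  then have "g = (\<lambda>t. \<Sum>n. f n t)" by (auto simp: sums_iff)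
  then show ?thesis using g(2) by simp
qed

section \<open>The time profile of a single slot\<close>

definition hat :: "real \<Rightarrow> real" where
  "hat u = 4 * (max 0 u - 2 * max 0 (u - 1/2) + max 0 (u - 1))"

text \<open>\<open>hat\<close> is the tent over [0,1] with peak 2 and integral 1, and
  \<open>ramp\<close> is its primitive, climbing from 0 to 1. A slot driven at speed
  \<open>hat\<close> starts and stops at rest, which keeps the field continuous in time.\<close>

definition ramp :: "real \<Rightarrow> real" where
  "ramp u = 2 * ((max 0 u)\<^sup>2 - 2 * (max 0 (u - 1/2))\<^sup>2 + (max 0 (u - 1))\<^sup>2)"

lemma hat_bounds: "0 \<le> hat u" "hat u \<le> 2"
  by (auto simp: hat_def max_def)

lemma hat_eq_0: "u \<le> 0 \<or> 1 \<le> u \<Longrightarrow> hat u = 0"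
  by (auto simp: hat_def max_def)

text \<open>The constant is \<open>4 * (1 + 2 + 1)\<close>, summed over the three positive
  parts.\<close>

lemma hat_lipschitz: "16-lipschitz_on UNIV hat"
proof (rule lipschitz_onI)
  show "dist (hat x) (hat y) \<le> 16 * dist x y" for x y
    unfolding hat_def dist_real_def max_def abs_real_def by (simp split: if_split)
qed simp

lemma ramp_eq_0: "u \<le> 0 \<Longrightarrow> ramp u = 0"
  by (simp add: ramp_def max_def)

lemma ramp_eq_1: "1 \<le> u \<Longrightarrow> ramp u = 1"
  by (simp add: ramp_def max_def power2_eq_square algebra_simps)

lemma has_real_derivative_max_0_square:
  "((\<lambda>u::real. (max 0 u)\<^sup>2) has_real_derivative 2 * max 0 u) (at u)"
proof -
  consider "u < 0" | "u = 0" | "u > 0" by linarith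
  then show ?thesis
  proof cases
    case 1
    have "((\<lambda>u::real. 0) has_real_derivative 2 * max 0 u) (at u)" using 1 by simp
    then show ?thesis
      by (rule has_field_derivative_transform_within_open[of _ _ _ "{..<0}"]) (use 1 in auto)
  next
    case 3
    have "((\<lambda>u::real. u\<^sup>2) has_real_derivative 2 * max 0 u) (at u)"
      using 3 by (auto intro!: derivative_eq_intros)
    then show ?thesis
      by (rule has_field_derivative_transform_within_open[of _ _ _ "{0<..}"]) (use 3 in auto)
  next
    case 2
    have "((\<lambda>h::real. (max 0 h)\<^sup>2 / h) \<longlongrightarrow> 0) (at 0)"
    proof (rule Lim_null_comparison)
      show "\<forall>\<^sub>F h in at (0::real). norm ((max 0 h)\<^sup>2 / h) \<le> \<bar>h\<bar>"
        by (auto simp: max_def power2_eq_square intro!: always_eventually)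
      show "((\<lambda>h::real. \<bar>h\<bar>) \<longlongrightarrow> 0) (at 0)"
        by (rule tendsto_rabs_zero) (rule tendsto_ident_at)
    qed
    then show ?thesis using 2 by (simp add: DERIV_def)
  qed
qed

lemma ramp_deriv [derivative_intros]:
  assumes "(g has_real_derivative g') (at t)"
  shows "((\<lambda>t. ramp (g t)) has_real_derivative hat (g t) * g') (at t)"
proof -
  have "(ramp has_real_derivative hat u) (at u)" for u
  proof -
    have d: "((\<lambda>u. (max 0 (u - c))\<^sup>2) has_real_derivative 2 * max 0 (u - c)) (at u)" for c :: real
      using DERIV_chain2[OF has_real_derivative_max_0_square, of "\<lambda>u. u - c" 1 u UNIV]
      by (simp add: DERIV_ident DERIV_diff[OF DERIV_ident DERIV_const, simplified])
    have "((\<lambda>u. 2 * ((max 0 (u - 0))\<^sup>2 - 2 * (max 0 (u - 1/2))\<^sup>2 + (max 0 (u - 1))\<^sup>2)) has_real_derivative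
        2 * (2 * max 0 (u - 0) - 2 * (2 * max 0 (u - 1/2)) + 2 * max 0 (u - 1))) (at u)"
      by (intro DERIV_cmult DERIV_add DERIV_diff d)
    then show ?thesis
      by (simp add: ramp_def[abs_def] hat_def algebra_simps)
  qed
  from DERIV_chain2[OF this assms] show ?thesis .
qed

section \<open>Bi-Lipschitz maps\<close>

definition bi_lipschitz :: "('a::metric_space \<Rightarrow> 'b::metric_space) \<Rightarrow> bool" where
  "bi_lipschitz f \<longleftrightarrow> (\<exists>A. \<exists>B>0. \<forall>x y. B * dist x y \<le> dist (f x) (f y) \<and> dist (f x) (f y) \<le> A * dist x y)"

lemma bi_lipschitz_id: "bi_lipschitz (\<lambda>x. x)"
  unfolding bi_lipschitz_def by (intro exI[of _ 1]) auto

lemma bi_lipschitz_compose: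
  assumes "bi_lipschitz f" "bi_lipschitz g"
  shows "bi_lipschitz (\<lambda>x. f (g x))"
proof -
  obtain A B where f: "B > 0" "\<And>x y. B * dist x y \<le> dist (f x) (f y)" "\<And>x y. dist (f x) (f y) \<le> A * dist x y"
    using assms(1) unfolding bi_lipschitz_def by blast
  obtain A' B' where g: "B' > 0" "\<And>x y. B' * dist x y \<le> dist (g x) (g y)" "\<And>x y. dist (g x) (g y) \<le> A' * dist x y"
    using assms(2) unfolding bi_lipschitz_def by blast
  have "B * B' * dist x y \<le> dist (f (g x)) (f (g y))" for x y
    using order_trans[OF mult_left_mono[OF g(2)[of x y], of B] f(2)[of "g x" "g y"]] f(1)
    by (simp add: mult.assoc)
  \<comment> \<open>\<open>A\<close> carries no sign condition, hence the absolute value.\<close>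
  moreover have "dist (f (g x)) (f (g y)) \<le> (\<bar>A\<bar> * A') * dist x y" for x y
  proof -
    have "dist (f (g x)) (f (g y)) \<le> \<bar>A\<bar> * dist (g x) (g y)"
      using order_trans[OF f(3)[of "g x" "g y"] mult_right_mono[OF abs_ge_self]] by simp
    also have "\<dots> \<le> \<bar>A\<bar> * (A' * dist x y)" by (intro mult_left_mono g(3)) simp
    finally show ?thesis by (simp add: mult.assoc)
  qed
  ultimately show ?thesis
    unfolding bi_lipschitz_def using f(1) g(1) by (intro exI[of _ "\<bar>A\<bar> * A'"] exI[of _ "B * B'"]) simp
qed

section \<open>The flow of countably many shears in successive time slots\<close>

locale shear_flow =
  fixes f :: "nat \<Rightarrow> real \<Rightarrow> real" and M L :: "nat \<Rightarrow> real"
  assumes lip: "(L n)-lipschitz_on UNIV (f n)"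
    and f_bound: "\<bar>f n u\<bar> \<le> M n"
    and M_pos: "0 < M n"
    and summable_sqrt_M: "summable (\<lambda>n. sqrt (M n))"
begin

text \<open>\<open>src n\<close> is the coordinate that shear \<open>n\<close> reads and preserves,
  \<open>dst n\<close> the one it moves, by \<open>f n\<close> in total. Even shears are vertical,
  odd ones horizontal.\<close>

definition src :: "nat \<Rightarrow> 2" where "src n = (if even n then 1 else 2)"
definition dst :: "nat \<Rightarrow> 2" where "dst n = (if even n then 2 else 1)"
definition V :: "nat \<Rightarrow> real^2 \<Rightarrow> real^2" where "V n x = f n (x $ src n) *\<^sub>R axis (dst n) 1"

fun pos :: "nat \<Rightarrow> real^2 \<Rightarrow> real^2" where
  "pos 0 a = a"
| "pos (Suc n) a = pos n a + V n (pos n a)"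

text \<open>Since \<open>M n / sqrt (M n) = sqrt (M n)\<close>, slots of length proportional to \<open>sqrt (M n)\<close> make the
  lengths and the maximal speeds summable at the same time.\<close>

definition duration :: "nat \<Rightarrow> real" where "duration n = sqrt (M n) / (\<Sum>k. sqrt (M k))"
definition start :: "nat \<Rightarrow> real" where "start n = (\<Sum>k<n. duration k)"
definition progress :: "nat \<Rightarrow> real \<Rightarrow> real" where "progress n t = ramp ((t - start n) / duration n)"
definition rate :: "nat \<Rightarrow> real \<Rightarrow> real" where "rate n t = hat ((t - start n) / duration n) / duration n"

text \<open>Series over all slots replace a case distinction: one formula covers every real time,
  including time 1 where the slots accumulate.\<close>

definition W :: "real \<Rightarrow> real^2 \<Rightarrow> real^2" where "W t x = (\<Sum>n. rate n t *\<^sub>R V n x)"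
definition X :: "real \<Rightarrow> real^2 \<Rightarrow> real^2" where "X t a = a + (\<Sum>n. progress n t *\<^sub>R V n (pos n a))"

lemma src_dst: "src n \<noteq> dst n"
  by (simp add: src_def dst_def)

lemma V_src [simp]: "V n x $ src n = 0"
  using src_dst[of n] by (simp add: V_def axis_def)

text \<open>A shear does not move the coordinate that it reads. This is what makes its flow and its
  inverse explicit.\<close>

lemma V_shear: "V n (x + c *\<^sub>R V n y) = V n x"
  using V_src[of n y] by (simp add: V_def[of n "x + _"] V_def[of n x])

lemma V_cong: "x $ src n = y $ src n \<Longrightarrow> V n x = V n y"
  by (simp add: V_def)

lemma norm_V: "norm (V n x) \<le> M n"
  using f_bound by (simp add: V_def norm_axis_1)

lemma V_lipschitz: "(L n)-lipschitz_on UNIV (V n)"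
proof (rule lipschitz_onI)
  fix x y :: "real^2"
  have "dist (V n x) (V n y) = \<bar>f n (x $ src n) - f n (y $ src n)\<bar>"
    by (simp add: V_def dist_norm norm_axis_1 flip: scaleR_left_diff_distrib)
  also have "\<dots> \<le> L n * \<bar>x $ src n - y $ src n\<bar>"
    using lipschitz_onD[OF lip] by (simp add: dist_real_def)
  also have "\<dots> \<le> L n * dist x y"
    using component_le_norm_cart[of "x - y" "src n"] lipschitz_on_nonneg[OF lip]
    by (intro mult_left_mono) (auto simp: dist_norm)
  finally show "dist (V n x) (V n y) \<le> L n * dist x y" .
qed (rule lipschitz_on_nonneg[OF lip])

lemma sum_sqrt_M_pos: "(\<Sum>k. sqrt (M k)) > 0"
  using M_pos by (intro suminf_pos summable_sqrt_M) simp

lemma duration_pos: "duration n > 0"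
  using sum_sqrt_M_pos M_pos by (simp add: duration_def)

lemma start_0 [simp]: "start 0 = 0" and start_Suc: "start (Suc n) = start n + duration n"
  by (simp_all add: start_def)

lemma start_tendsto: "start \<longlonglongrightarrow> 1"
proof -
  have "duration sums ((\<Sum>k. sqrt (M k)) / (\<Sum>k. sqrt (M k)))"
    unfolding duration_def by (intro sums_divide summable_sums summable_sqrt_M)
  then show ?thesis using sum_sqrt_M_pos unfolding sums_def start_def by simp
qed

lemma start_mono: "m \<le> n \<Longrightarrow> start m \<le> start n"
  by (rule lift_Suc_mono_le[of start]) (use duration_pos in \<open>simp_all add: start_Suc less_imp_le\<close>)

lemma start_le_1: "start n \<le> 1"
  using start_mono start_tendsto by (intro incseq_le) (simp_all add: incseq_def)

lemma slot_exists:
  assumes "0 \<le> t" "t < 1"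
  obtains n where "start n \<le> t" "t \<le> start (Suc n)"
proof -
  from order_tendstoD(1)[OF start_tendsto assms(2)] obtain N where "t < start N"
    by (auto simp: eventually_sequentially)
  then have ex: "\<exists>N. t < start N" by blast
  define m where "m = (LEAST N. t < start N)"
  have m: "t < start m" unfolding m_def using ex by (rule LeastI_ex)
  then obtain n where n: "m = Suc n" using assms(1) by (cases m) auto
  then have "\<not> t < start n" unfolding m_def using not_less_Least[of n "\<lambda>N. t < start N"] by simp
  with m n that[of n] show ?thesis by (simp add: less_imp_le)
qed

lemma progress_after: "start (Suc n) \<le> t \<Longrightarrow> progress n t = 1"
  using duration_pos[of n] by (simp add: progress_def ramp_eq_1 start_Suc)

lemma progress_before: "t \<le> start n \<Longrightarrow> progress n t = 0"
  using duration_pos[of n] by (simp add: progress_def ramp_eq_0 divide_nonpos_pos)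

lemma rate_eq_0: "t \<le> start n \<or> start (Suc n) \<le> t \<Longrightarrow> rate n t = 0"
  using duration_pos[of n] by (auto simp: rate_def start_Suc divide_nonpos_pos intro!: hat_eq_0)

lemma progress_deriv: "(progress n has_real_derivative rate n t) (at t)"
  unfolding progress_def rate_def using duration_pos[of n] by (auto intro!: derivative_eq_intros simp: field_simps)

lemma abs_rate: "\<bar>rate n t\<bar> \<le> 2 / duration n"
  using hat_bounds duration_pos[of n] by (auto simp: rate_def intro!: divide_right_mono)

lemma rate_lipschitz: "(16 / duration n * (1 / duration n))-lipschitz_on UNIV (rate n)"
proof (rule lipschitz_onI)
  fix s t :: real
  have "dist (rate n s) (rate n t) = dist (hat ((s - start n) / duration n)) (hat ((t - start n) / duration n)) / duration n"
    using duration_pos[of n] by (simp add: rate_def dist_real_def flip: diff_divide_distrib)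
  also have "\<dots> \<le> 16 * dist ((s - start n) / duration n) ((t - start n) / duration n) / duration n"
    using duration_pos[of n] lipschitz_onD[OF hat_lipschitz] by (intro divide_right_mono) auto
  also have "\<dots> = 16 / duration n * (1 / duration n) * dist s t"
    using duration_pos[of n] by (simp add: dist_real_def flip: diff_divide_distrib)
  finally show "dist (rate n s) (rate n t) \<le> 16 / duration n * (1 / duration n) * dist s t" .
qed (use duration_pos[of n] in simp)

lemma norm_rate_V: "norm (rate n t *\<^sub>R V n x) \<le> 2 * (\<Sum>k. sqrt (M k)) * sqrt (M n)"
proof -
  have "norm (rate n t *\<^sub>R V n x) \<le> 2 / duration n * M n"
    using abs_rate[of n t] norm_V[of n x] duration_pos[of n] unfolding norm_scaleR by (intro mult_mono) auto
  also have "\<dots> = 2 * (\<Sum>k. sqrt (M k)) * (M n / sqrt (M n))" by (simp add: duration_def)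
  also have "M n / sqrt (M n) = sqrt (M n)" using M_pos[of n] by (simp add: real_div_sqrt)
  finally show ?thesis .
qed

lemma summable_majorant: "summable (\<lambda>n. 2 * (\<Sum>k. sqrt (M k)) * sqrt (M n))"
  by (intro summable_mult summable_sqrt_M)

text \<open>The field of one slot is a product of bounded Lipschitz factors, hence Lipschitz. The
  majorant \<open>sqrt (M n)\<close>, up to a constant, makes the series converge uniformly on
  space-time, and uniform continuity survives the limit.\<close>

lemma uniformly_continuous_W: "uniformly_continuous_on UNIV (\<lambda>z. W (fst z) (snd z))"
proof (rule uniformly_continuous_on_uniform_limit)
  show "uniform_limit UNIV (\<lambda>n z. \<Sum>i<n. rate i (fst z) *\<^sub>R V i (snd z)) (\<lambda>z. W (fst z) (snd z)) sequentially"
    unfolding W_def using norm_rate_V summable_majorant by (rule Weierstrass_m_test)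
  have fst1: "1-lipschitz_on UNIV (fst :: real \<times> (real^2) \<Rightarrow> real)"
    by (intro lipschitz_onI) (auto simp: dist_fst_le)
  have snd1: "1-lipschitz_on UNIV (snd :: real \<times> (real^2) \<Rightarrow> real^2)"
    by (intro lipschitz_onI) (auto simp: dist_snd_le)
  have "uniformly_continuous_on UNIV (\<lambda>z. rate i (fst z) *\<^sub>R V i (snd z))" for i
  proof -
    have "(16 / duration i * (1 / duration i) * 1)-lipschitz_on UNIV (\<lambda>z::real \<times> (real^2). rate i (fst z))"
      by (rule lipschitz_on_compose2[OF fst1]) (rule lipschitz_on_subset[OF rate_lipschitz], simp)
    moreover have "(L i * 1)-lipschitz_on UNIV (\<lambda>z::real \<times> (real^2). V i (snd z))"
      by (rule lipschitz_on_compose2[OF snd1]) (rule lipschitz_on_subset[OF V_lipschitz], simp)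
    ultimately show ?thesis
      using duration_pos[of i] M_pos[of i]
      by (intro lipschitz_on_uniformly_continuous[OF lipschitz_on_scaleR_bounded[OF _ _ abs_rate norm_V]])
        (assumption | simp add: less_imp_le)+
  qed
  then show "uniformly_continuous_on UNIV (\<lambda>z. \<Sum>i<n. rate i (fst z) *\<^sub>R V i (snd z))" for n
    by (intro uniformly_continuous_on_sum)
qed

text \<open>In every shear the component along axis \<open>i\<close> is 0 or a function of the other
  coordinate only.\<close>

lemma weakly_div_free_W: "weakly_div_free W"
proof (rule weakly_div_free_if_shift_invariant)
  show "continuous_on UNIV (\<lambda>z. W (fst z) (snd z))"
    by (rule uniformly_continuous_imp_continuous[OF uniformly_continuous_W])
  fix t x i and s :: real
  have sm: "summable (\<lambda>n. rate n t *\<^sub>R V n x)" for x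
    by (rule summable_comparison_test'[OF summable_majorant norm_rate_V])
  have comp: "W t x $ i = (\<Sum>n. rate n t * V n x $ i)" for x
    unfolding W_def using bounded_linear.suminf[OF bounded_linear_vec_nth sm[of x], of i] by simp
  have "V n (x + s *\<^sub>R axis i 1) $ i = V n x $ i" for n
    using src_dst[of n] by (cases "i = dst n") (auto simp: V_def axis_def)
  then show "W t (x + s *\<^sub>R axis i 1) $ i = W t x $ i"
    by (simp add: comp)
qed

text \<open>Earlier shears are complete and later ones have not begun, so the series reduces to a
  finite sum ending in a partial shear.\<close>

lemma X_slot:
  assumes "start n \<le> t" "t \<le> start (Suc n)"
  shows "X t a = pos n a + progress n t *\<^sub>R V n (pos n a)"
proof -
  have before: "progress k t = 0" if "k \<notin> {..n}" for k
    using assms(2) start_mono[of "Suc n" k] that by (intro progress_before) auto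
  have after: "progress k t = 1" if "k < n" for k
    using assms(1) start_mono[of "Suc k" n] that by (intro progress_after) auto
  have pos: "pos n a = a + (\<Sum>k<n. V k (pos k a))" for n
    by (induction n) auto
  have "(\<Sum>k. progress k t *\<^sub>R V k (pos k a)) = (\<Sum>k\<le>n. progress k t *\<^sub>R V k (pos k a))"
    using before by (intro suminf_finite) auto
  also have "\<dots> = (\<Sum>k<n. V k (pos k a)) + progress n t *\<^sub>R V n (pos n a)"
    using after by (simp add: lessThan_Suc_atMost[symmetric])
  finally show ?thesis using pos[of n] by (simp add: X_def)
qed

lemma W_slot:
  assumes "start n \<le> t" "t \<le> start (Suc n)"
  shows "W t x = rate n t *\<^sub>R V n x"
proof -
  have "rate k t = 0" if "k \<notin> {n}" for k
    using assms start_mono[of "Suc n" k] start_mono[of "Suc k" n] that by (intro rate_eq_0) (cases "k < n"; auto)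
  then show ?thesis unfolding W_def by (subst suminf_finite[of "{n}"]) auto
qed

lemma X_0 [simp]: "X 0 a = a"
  using X_slot[of 0 0] duration_pos[of 0] by (simp add: start_Suc progress_before)

text \<open>The majorant does not depend on time, so termwise differentiation works at time 1 as
  well.\<close>

lemma X_deriv: "((\<lambda>t. X t a) has_vector_derivative W t (X t a)) (at t)"
proof -
  \<comment> \<open>If \<open>rate n t\<close> is nonzero then \<open>t\<close> lies in slot
    \<open>n\<close>, where \<open>X t a\<close> differs from \<open>pos n a\<close> by a multiple
    of \<open>V n (pos n a)\<close>, which \<open>V n\<close> does not see.\<close>
  have *: "rate n t *\<^sub>R V n (X t a) = rate n t *\<^sub>R V n (pos n a)" for n
    using X_slot[of n t] rate_eq_0[of t n] V_shear by (cases "t \<le> start n \<or> start (Suc n) \<le> t") auto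
  have "((\<lambda>t. \<Sum>n. progress n t *\<^sub>R V n (pos n a)) has_vector_derivative (\<Sum>n. rate n t *\<^sub>R V n (pos n a))) (at t)"
  proof (rule has_vector_derivative_series[OF _ norm_rate_V summable_majorant])
    show "((\<lambda>t. progress n t *\<^sub>R V n (pos n a)) has_vector_derivative rate n t *\<^sub>R V n (pos n a)) (at t)" for n t
      using has_vector_derivative_scaleR[OF progress_deriv has_vector_derivative_const] by simp
    show "summable (\<lambda>n. progress n 0 *\<^sub>R V n (pos n a))"
      using start_mono[of 0] by (simp add: progress_before)
  qed
  then have "((\<lambda>t. X t a) has_vector_derivative (\<Sum>n. rate n t *\<^sub>R V n (pos n a))) (at t)"
    unfolding X_def using has_vector_derivative_add[OF has_vector_derivative_const] by fastforce
  then show ?thesis by (simp add: W_def *)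
qed

lemma trajectory_map_X: "trajectory_map 1 W UNIV X"
  unfolding trajectory_map_def by (simp add: X_deriv has_vector_derivative_at_within)

lemma pos_tendsto: "(\<lambda>n. pos n a) \<longlonglongrightarrow> X 1 a"
proof -
  have "continuous (at 1) (\<lambda>t. X t a)"
    using X_deriv has_vector_derivative_continuous by blast
  then have "(\<lambda>n. X (start n) a) \<longlonglongrightarrow> X 1 a"
    using start_tendsto by (rule isCont_tendsto_compose)
  moreover have "X (start n) a = pos n a" for n
    using X_slot[of n "start n"] duration_pos[of n] by (simp add: start_Suc progress_before)
  ultimately show ?thesis by simp
qed

text \<open>No Gronwall estimate is involved. In slot \<open>n\<close> the coordinate
  \<open>src n\<close> of any trajectory has derivative 0, so two trajectories that agree at the
  start of the slot see the same velocity and their difference is constant. Induction over the slots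
  covers times below 1, and continuity gives time 1.\<close>

lemma trajectory_unique:
  assumes Y: "trajectory_map 1 W UNIV Y" and t: "t \<in> {0..1}"
  shows "Y t a = X t a"
proof -
  have Y0: "Y 0 a = a" and Yd: "\<And>t. t \<in> {0..1} \<Longrightarrow> ((\<lambda>t. Y t a) has_vector_derivative W t (Y t a)) (at t within {0..1})"
    using bspec[OF Y[unfolded trajectory_map_def] UNIV_I, of a] by simp_all
  have step: "Y t a = X t a" if eq: "Y (start n) a = X (start n) a" and t: "t \<in> {start n..start (Suc n)}" for n t
  proof -
    define I where "I = {start n..start (Suc n)}"
    have I: "I \<subseteq> {0..1}" "convex I" "start n \<in> I"
      using start_mono[of 0 n] start_le_1[of "Suc n"] duration_pos[of n] by (simp_all add: I_def start_Suc)
    have YI: "((\<lambda>t. Y t a) has_vector_derivative rate n t *\<^sub>R V n (Y t a)) (at t within I)" if "t \<in> I" for t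
    proof -
      have "t \<in> {0..1}" using that I(1) by blast
      from has_vector_derivative_within_subset[OF Yd[OF this] I(1)] W_slot[of n t "Y t a"] that
      show ?thesis by (simp add: I_def)
    qed
    have XI: "((\<lambda>t. X t a) has_vector_derivative rate n t *\<^sub>R V n (X t a)) (at t within I)" if "t \<in> I" for t
      using has_vector_derivative_at_within[OF X_deriv[where t = t and a = a], where S = I] W_slot[of n t "X t a"] that
      by (simp add: I_def)
    have "\<exists>c. \<forall>t\<in>I. Y t a $ src n = c"
    proof (rule has_derivative_zero_constant[OF I(2)])
      fix t assume "t \<in> I"
      from bounded_linear.has_vector_derivative[OF bounded_linear_vec_nth YI[OF this], of "src n"]
      show "((\<lambda>t. Y t a $ src n) has_derivative (\<lambda>h. 0)) (at t within I)"
        by (simp add: has_vector_derivative_def)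
    qed
    then have "Y t a $ src n = X (start n) a $ src n" if "t \<in> I" for t
      using eq I(3) that by metis
    moreover have "X t a $ src n = X (start n) a $ src n" if "t \<in> I" for t
      using X_slot[of n t a] X_slot[of n "start n" a] I(3) that by (simp add: I_def)
    ultimately have "V n (Y t a) = V n (X t a)" if "t \<in> I" for t
      using that by (intro V_cong) simp
    then have "((\<lambda>t. Y t a - X t a) has_derivative (\<lambda>h. 0)) (at t within I)" if "t \<in> I" for t
      using has_vector_derivative_diff[OF YI[OF that] XI[OF that]] that by (simp add: has_vector_derivative_def)
    from has_derivative_zero_constant[OF I(2) this] obtain c where "\<And>t. t \<in> I \<Longrightarrow> Y t a - X t a = c"
      by blast
    from this[of t] this[of "start n"] eq I(3) t show ?thesis by (simp add: I_def)
  qed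
  have at_start: "Y (start n) a = X (start n) a" for n
  proof (induction n)
    case (Suc n)
    then show ?case using step[of n "start (Suc n)"] duration_pos[of n] by (simp add: start_Suc)
  qed (simp add: Y0)
  show ?thesis
  proof (cases "t < 1")
    case True
    then obtain n where "start n \<le> t" "t \<le> start (Suc n)" using slot_exists t by auto
    then show ?thesis using step at_start by auto
  next
    case False
    then have t1: "t = 1" using t by simp
    have in01: "start n \<in> {0..1}" for n using start_mono[of 0 n] start_le_1[of n] by simp
    have "continuous (at 1 within {0..1}) (\<lambda>t. Y t a)" "continuous (at 1 within {0..1}) (\<lambda>t. X t a)"
      using has_vector_derivative_continuous[OF Yd[of 1]]
        has_vector_derivative_continuous[OF has_vector_derivative_at_within[OF X_deriv]] by auto
    then have "(\<lambda>n. Y (start n) a) \<longlonglongrightarrow> Y 1 a" "(\<lambda>n. X (start n) a) \<longlonglongrightarrow> X 1 a"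
      using start_tendsto in01 by (auto elim!: continuous_within_tendsto_compose')
    then show ?thesis using at_start t1 LIMSEQ_unique by simp
  qed
qed

text \<open>The inverse is the shear with \<open>- c\<close>, which satisfies the same upper bound;
  applied to the images, that bound is the lower one.\<close>

lemma bi_lipschitz_shear: "bi_lipschitz (\<lambda>x. x + c *\<^sub>R V n x)"
proof -
  let ?A = "1 + \<bar>c\<bar> * L n" and ?g = "\<lambda>c x. x + c *\<^sub>R V n x"
  have upper: "dist (?g d x) (?g d y) \<le> ?A * dist x y" if "\<bar>d\<bar> = \<bar>c\<bar>" for d x y
  proof -
    have "dist (?g d x) (?g d y) \<le> dist x y + dist (d *\<^sub>R V n x) (d *\<^sub>R V n y)"
      by (rule dist_triangle_add)
    also have "dist (d *\<^sub>R V n x) (d *\<^sub>R V n y) \<le> \<bar>c\<bar> * (L n * dist x y)"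
      using lipschitz_onD[OF V_lipschitz, of x y n] that
      by (simp add: dist_norm mult_left_mono flip: scaleR_right_diff_distrib)
    finally show ?thesis by (simp add: algebra_simps)
  qed
  have inv: "?g (- c) (?g c x) = x" for x by (simp add: V_shear)
  have A: "?A > 0" using lipschitz_on_nonneg[OF V_lipschitz[of n]] by (simp add: add_pos_nonneg)
  have "1 / ?A * dist x y \<le> dist (?g c x) (?g c y)" for x y
    using upper[of "- c" "?g c x" "?g c y"] A unfolding inv by (simp add: divide_le_eq mult.commute)
  then show ?thesis
    unfolding bi_lipschitz_def using upper[of c] A by (intro exI[of _ ?A] exI[of _ "1 / ?A"]) auto
qed

text \<open>Before time 1 only finitely many shears have begun, so the flow map is a finite
  composition.\<close>

lemma bi_lipschitz_X:
  assumes "0 \<le> t" "t < 1"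
  shows "bi_lipschitz (X t)"
proof -
  obtain n where n: "start n \<le> t" "t \<le> start (Suc n)" using slot_exists assms by blast
  have "bi_lipschitz (pos n)" for n
  proof (induction n)
    case (Suc n)
    then show ?case using bi_lipschitz_compose[OF bi_lipschitz_shear[of 1 n]] by simp
  qed (simp add: bi_lipschitz_id)
  from bi_lipschitz_compose[OF bi_lipschitz_shear[of "progress n t" n] this[of n]]
  have "bi_lipschitz (\<lambda>a. X t a)" using X_slot[OF n] by simp
  then show ?thesis by simp
qed

end

section \<open>Hausdorff dimension of Cantor sets\<close>

lemma first_difference:
  fixes c c' :: "nat \<Rightarrow> 'd"
  assumes "c \<noteq> c'"
  obtains n where "\<And>k. k < n \<Longrightarrow> c k = c' k" "c n \<noteq> c' n"
proof -
  have ex: "\<exists>n. c n \<noteq> c' n" using assms by auto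
  show ?thesis
    using that[of "LEAST n. c n \<noteq> c' n"] LeastI_ex[OF ex] not_less_Least[of _ "\<lambda>n. c n \<noteq> c' n"] by blast
qed

text \<open>The cover consists of the images of the cylinders, one for each word of length
  \<open>n\<close>.\<close>

lemma hausdorff_pre_range_le:
  fixes P :: "(nat \<Rightarrow> 'd::finite) \<Rightarrow> 'a::real_normed_vector"
  assumes P: "\<And>c c'. (\<And>k. k < n \<Longrightarrow> c k = c' k) \<Longrightarrow> dist (P c) (P c') \<le> \<eta>"
    and \<eta>: "0 \<le> \<eta>" "\<eta> \<le> \<delta>" and s: "0 \<le> s"
  shows "hausdorff_pre s \<delta> (range P) \<le> ennreal (real (CARD('d) ^ n) * \<eta> powr s)"
proof -
  define F where "F = {xs :: 'd list. set xs \<subseteq> UNIV \<and> length xs = n}"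
  have F: "finite F" "card F = CARD('d) ^ n"
    unfolding F_def by (rule finite_lists_length_eq) (use card_lists_length_eq[of "UNIV :: 'd set" n] in simp_all)
  obtain g where g: "bij_betw g {0..<card F} F" using ex_bij_betw_nat_finite[OF F(1)] by blast
  define Z where "Z xs = P ` {c. map c [0..<n] = xs}" for xs
  \<comment> \<open>Covers are infinite sequences, so the finite one is padded with empty sets. The
    padding costs nothing even for \<open>s = 0\<close>, since \<open>0 powr 0 = 0\<close>.\<close>
  define C where "C i = (if i < card F then Z (g i) else {})" for i
  have dist_Z: "dist x y \<le> \<eta>" if "x \<in> Z xs" "y \<in> Z xs" for x y xs
    using that unfolding Z_def by (auto intro!: P)
  have C: "bounded (C i)" "diameter (C i) \<le> \<eta>" for i
  proof -
    have d: "dist x y \<le> \<eta>" if "x \<in> C i" "y \<in> C i" for x y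
      using that dist_Z by (auto simp: C_def split: if_splits)
    then show "diameter (C i) \<le> \<eta>" using \<eta>(1) by (intro diameter_le) (auto simp: dist_norm)
    show "bounded (C i)" using d unfolding bounded_def by blast
  qed
  have cover: "range P \<subseteq> (\<Union>i. C i)"
  proof
    fix x assume "x \<in> range P"
    then obtain c where c: "x = P c" by auto
    have "map c [0..<n] \<in> F" by (simp add: F_def)
    then obtain i where "i < card F" "g i = map c [0..<n]"
      using g unfolding bij_betw_def by (metis atLeastLessThan_iff imageE)
    then have "x \<in> C i" by (auto simp: C_def Z_def c)
    then show "x \<in> (\<Union>i. C i)" by blast
  qed
  have "hausdorff_pre s \<delta> (range P) \<le> (\<Sum>i. ennreal (diameter (C i) powr s))"
    unfolding hausdorff_pre_def using cover C(1) order_trans[OF C(2) \<eta>(2)] by (intro INF_lower) simp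
  also have "\<dots> = (\<Sum>i<card F. ennreal (diameter (C i) powr s))"
    by (intro suminf_finite) (auto simp: C_def)
  also have "\<dots> \<le> (\<Sum>i<card F. ennreal (\<eta> powr s))"
    using C s by (intro sum_mono ennreal_leI powr_mono2) (auto simp: diameter_ge_0)
  also have "\<dots> = ennreal (real (CARD('d) ^ n) * \<eta> powr s)"
    by (simp add: F(2) ennreal_mult ennreal_of_nat_eq_real_of_nat ennreal_power)
  finally show ?thesis .
qed

text \<open>The cover by cylinders of length \<open>n\<close> costs at most \<open>A powr s\<close>
  times the nth power of \<open>CARD('d) * r powr s\<close>, which tends to 0.\<close>

lemma hausdorff_measure_range_eq_0:
  fixes P :: "(nat \<Rightarrow> 'd::finite) \<Rightarrow> 'a::real_normed_vector"
  assumes P: "\<And>c c' n. (\<And>k. k < n \<Longrightarrow> c k = c' k) \<Longrightarrow> dist (P c) (P c') \<le> A * r ^ n"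
    and r: "0 < r" "r < 1" and s: "0 \<le> s" "CARD('d) * r powr s < 1"
  shows "hausdorff_measure s (range P) = 0"
proof -
  have A: "0 \<le> A" using P[of 0 undefined undefined] by simp
  have "hausdorff_pre s \<delta> (range P) \<le> 0" if "\<delta> > 0" for \<delta>
  proof (rule tendsto_lowerbound)
    have "(\<lambda>n. ennreal (A powr s * (CARD('d) * r powr s) ^ n)) \<longlonglongrightarrow> ennreal (A powr s * 0)"
      using s by (intro tendsto_ennrealI tendsto_mult_left LIMSEQ_power_zero) simp
    then show "(\<lambda>n. ennreal (A powr s * (CARD('d) * r powr s) ^ n)) \<longlonglongrightarrow> 0" by simp
    have "(\<lambda>n. A * r ^ n) \<longlonglongrightarrow> A * 0"
      using r by (intro tendsto_mult_left LIMSEQ_power_zero) simp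
    then have "\<forall>\<^sub>F n in sequentially. A * r ^ n < \<delta>"
      using that by (intro order_tendstoD) auto
    then show "\<forall>\<^sub>F n in sequentially. hausdorff_pre s \<delta> (range P) \<le> ennreal (A powr s * (CARD('d) * r powr s) ^ n)"
    proof (rule eventually_mono)
      fix n assume n: "A * r ^ n < \<delta>"
      have "(r ^ n) powr s = (r powr s) ^ n"
        using r by (simp add: powr_powr mult.commute flip: powr_realpow)
      then have "real (CARD('d) ^ n) * (A * r ^ n) powr s = A powr s * (CARD('d) * r powr s) ^ n"
        using A r by (simp add: powr_mult power_mult_distrib)
      then show "hausdorff_pre s \<delta> (range P) \<le> ennreal (A powr s * (CARD('d) * r powr s) ^ n)"
        using hausdorff_pre_range_le[of n P "A * r ^ n" \<delta> s] P n A r s by simp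
    qed
  qed simp
  then show ?thesis
    unfolding hausdorff_measure_def by (intro antisym SUP_least) auto
qed

section \<open>Lower bound for the dimension: base expansions of codes\<close>

lemma base_expansion:
  fixes m :: nat and x :: real
  assumes m: "2 \<le> m" and x: "0 \<le> x" "x < 1"
  obtains d where "\<And>k. d k < m" "(\<lambda>k. real (d k) / real m ^ Suc k) sums x"
proof -
  \<comment> \<open>Digit \<open>k\<close> is the part of the floor of \<open>m ^ Suc k * x\<close>
    not already accounted for one place earlier; this makes the partial sums telescope.\<close>
  define d where "d k = nat (\<lfloor>real m ^ Suc k * x\<rfloor> - int m * \<lfloor>real m ^ k * x\<rfloor>)" for k
  have lo: "int m * \<lfloor>real m ^ k * x\<rfloor> \<le> \<lfloor>real m ^ Suc k * x\<rfloor>" for k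
  proof -
    have "real_of_int (int m * \<lfloor>real m ^ k * x\<rfloor>) \<le> real m ^ Suc k * x"
      using mult_left_mono[of "real_of_int \<lfloor>real m ^ k * x\<rfloor>" "real m ^ k * x" "real m"] by (simp add: mult.assoc)
    then show ?thesis by (simp add: le_floor_iff)
  qed
  have hi: "\<lfloor>real m ^ Suc k * x\<rfloor> < int m * \<lfloor>real m ^ k * x\<rfloor> + int m" for k
  proof -
    have "real m * (real m ^ k * x) < real m * (real_of_int \<lfloor>real m ^ k * x\<rfloor> + 1)"
      using m by (intro mult_strict_left_mono) (simp_all add: real_of_int_floor_add_one_gt)
    then show ?thesis by (simp add: floor_less_iff algebra_simps)
  qed
  have "d k < m" for k using lo[of k] hi[of k] by (simp add: d_def)
  moreover have "(\<lambda>k. real (d k) / real m ^ Suc k) sums x"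
  proof -
    have partial: "(\<Sum>k<n. real (d k) / real m ^ Suc k) = real_of_int \<lfloor>real m ^ n * x\<rfloor> / real m ^ n" for n
    proof (induction n)
      case 0
      have "\<lfloor>x\<rfloor> = 0" using x by (simp add: floor_eq_iff)
      then show ?case by simp
    next
      case (Suc n)
      have "real (d n) = real_of_int \<lfloor>real m ^ Suc n * x\<rfloor> - real m * real_of_int \<lfloor>real m ^ n * x\<rfloor>"
        using lo[of n] by (simp add: d_def)
      then show ?case using Suc m by (simp add: field_simps)
    qed
    have "(\<lambda>n. real_of_int \<lfloor>real m ^ n * x\<rfloor> / real m ^ n) \<longlonglongrightarrow> x"
    proof (rule real_tendsto_sandwich)
      have "(\<lambda>n. x - (1 / real m) ^ n) \<longlonglongrightarrow> x - 0"
        using m by (intro tendsto_diff tendsto_const LIMSEQ_power_zero) simp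
      then show "(\<lambda>n. x - (1 / real m) ^ n) \<longlonglongrightarrow> x" by simp
      show "\<forall>\<^sub>F n in sequentially. x - (1 / real m) ^ n \<le> real_of_int \<lfloor>real m ^ n * x\<rfloor> / real m ^ n"
      proof (intro always_eventually allI)
        fix n
        have "real m ^ n * x < real_of_int \<lfloor>real m ^ n * x\<rfloor> + 1" by (rule real_of_int_floor_add_one_gt)
        then have "x * real m ^ n - 1 \<le> real_of_int \<lfloor>real m ^ n * x\<rfloor>" by (simp add: mult.commute)
        then have "(x * real m ^ n - 1) / real m ^ n \<le> real_of_int \<lfloor>real m ^ n * x\<rfloor> / real m ^ n"
          by (rule divide_right_mono) simp
        then show "x - (1 / real m) ^ n \<le> real_of_int \<lfloor>real m ^ n * x\<rfloor> / real m ^ n"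
          using m by (simp add: diff_divide_distrib power_one_over)
      qed
      show "\<forall>\<^sub>F n in sequentially. real_of_int \<lfloor>real m ^ n * x\<rfloor> / real m ^ n \<le> x"
        using m by (intro always_eventually allI) (simp add: divide_le_eq mult.commute)
    qed simp
    then show ?thesis unfolding sums_def by (simp only: partial)
  qed
  ultimately show ?thesis using that by blast
qed

lemma base_expansion_dist:
  fixes d d' :: "nat \<Rightarrow> nat"
  assumes m: "2 \<le> m" and d: "\<And>k. d k < m" "\<And>k. d' k < m" and eq: "\<And>k. k < n \<Longrightarrow> d k = d' k"
  shows "\<bar>(\<Sum>k. real (d k) / real m ^ Suc k) - (\<Sum>k. real (d' k) / real m ^ Suc k)\<bar> \<le> (1 / real m) ^ n"
proof -
  let ?q = "1 / real m"
  \<comment> \<open>The extreme case: digit \<open>m - 1\<close> at every place from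
    \<open>n\<close> on sums to exactly \<open>(1 / m) ^ n\<close>.\<close>
  have geo: "(\<lambda>k. (real m - 1) * ?q ^ Suc (k + n)) sums ?q ^ n"
  proof -
    have "(\<lambda>k. ((real m - 1) * ?q ^ Suc n) * ?q ^ k) sums (((real m - 1) * ?q ^ Suc n) * (1 / (1 - ?q)))"
      using m by (intro sums_mult geometric_sums) simp
    also have "((real m - 1) * ?q ^ Suc n) * (1 / (1 - ?q)) = ?q ^ n"
      using m by (simp add: field_simps)
    finally show ?thesis by (simp add: power_add mult_ac)
  qed
  have sm: "summable (\<lambda>k. real (d k) / real m ^ Suc k)" if "\<And>k. d k < m" for d :: "nat \<Rightarrow> nat"
  proof (rule summable_comparison_test')
    show "summable (\<lambda>k. ?q ^ k)" using m by (intro summable_geometric) simp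
    show "norm (real (d k) / real m ^ Suc k) \<le> ?q ^ k" for k
      using that[of k] m by (simp add: field_simps power_divide)
  qed
  define u where "u k = real (d k) / real m ^ Suc k - real (d' k) / real m ^ Suc k" for k
  have u: "summable u" unfolding u_def using sm d by (intro summable_diff) auto
  have "(\<Sum>k. real (d k) / real m ^ Suc k) - (\<Sum>k. real (d' k) / real m ^ Suc k) = suminf u"
    unfolding u_def using sm d by (intro suminf_diff) auto
  also have "\<dots> = (\<Sum>k. u (k + n))"
    using suminf_split_initial_segment[OF u, of n] eq by (simp add: u_def)
  also have "\<bar>\<dots>\<bar> \<le> ?q ^ n"
  proof -
    have le: "norm (u (k + n)) \<le> (real m - 1) * ?q ^ Suc (k + n)" for k
    proof -
      have "\<bar>real (d (k + n)) - real (d' (k + n))\<bar> \<le> real m - 1"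
        using d[of "k + n"] m by linarith
      then have "\<bar>real (d (k + n)) - real (d' (k + n))\<bar> / real m ^ Suc (k + n) \<le> (real m - 1) / real m ^ Suc (k + n)"
        by (intro divide_right_mono) auto
      then show ?thesis
        using m by (simp add: u_def power_one_over flip: diff_divide_distrib)
    qed
    then have "norm (\<Sum>k. u (k + n)) \<le> (\<Sum>k. (real m - 1) * ?q ^ Suc (k + n))"
      by (rule norm_suminf_le) (rule sums_summable[OF geo])
    then show ?thesis using geo by (simp add: sums_iff)
  qed
  finally show ?thesis .
qed

text \<open>Reading the code of a point as a base-\<open>CARD('d)\<close> expansion maps the Cantor set onto
  \<open>[0,1)\<close>, and this map is Hoelder continuous of exponent \<open>h\<close>; so Lebesgue measure on the interval
  takes the place of a mass distribution on the Cantor set.\<close>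

lemma hausdorff_measure_range_pos:
  fixes P :: "(nat \<Rightarrow> 'd::finite) \<Rightarrow> 'a::metric_space"
  assumes P: "\<And>c c' n. (\<And>k. k < n \<Longrightarrow> c k = c' k) \<Longrightarrow> c n \<noteq> c' n \<Longrightarrow> B * r ^ n \<le> dist (P c) (P c')"
    and B: "0 < B" and r: "0 < r" and h: "0 < h" "CARD('d) * r powr h = 1"
    and card: "2 \<le> CARD('d)" and s: "0 \<le> s" "s \<le> h"
  shows "hausdorff_measure s (range P) \<noteq> 0"
proof -
  define m where "m = CARD('d)"
  obtain e where e: "bij_betw e (UNIV :: 'd set) {0..<m}"
    using ex_bij_betw_finite_nat[of "UNIV :: 'd set"] by (auto simp: m_def)
  have e_lt: "e x < m" for x using e by (auto simp: bij_betw_def)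
  define F where "F c = (\<Sum>k. real (e (c k)) / real m ^ Suc k)" for c :: "nat \<Rightarrow> 'd"
  \<comment> \<open>Chosen so that \<open>K * (B * r ^ n) powr h\<close> equals
    \<open>(r ^ n) powr h\<close>, which is \<open>(1 / m) ^ n\<close>.\<close>
  define K where "K = B powr - h"
  have K: "K > 0" using B by (simp add: K_def)
  have m: "2 \<le> m" using card by (simp add: m_def)
  have F_dist: "\<bar>F c - F c'\<bar> \<le> K * dist (P c) (P c') powr h" for c c'
  proof (cases "c = c'")
    case False
    then obtain n where n: "\<And>k. k < n \<Longrightarrow> c k = c' k" "c n \<noteq> c' n" using first_difference by blast
    have "\<bar>F c - F c'\<bar> \<le> (1 / real m) ^ n"
      unfolding F_def using n(1) by (intro base_expansion_dist m e_lt) simp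
    also have "1 / real m = r powr h" using h(2) m by (simp add: m_def field_simps)
    also have "(r powr h) ^ n = (r ^ n) powr h"
      using r by (simp add: powr_powr mult.commute flip: powr_realpow)
    also have "\<dots> = K * (B * r ^ n) powr h"
      using B r by (simp add: K_def powr_mult powr_minus)
    also have "\<dots> \<le> K * dist (P c) (P c') powr h"
      using P[of n c c', OF n] K B r h by (intro mult_left_mono powr_mono2) auto
    finally show ?thesis .
  qed (use K in simp)
  have surj: "\<exists>c. F c = x" if x: "0 \<le> x" "x < 1" for x
  proof -
    obtain d where d: "\<And>k. d k < m" "(\<lambda>k. real (d k) / real m ^ Suc k) sums x"
      using base_expansion[OF m x] by blast
    have "e (inv e (d k)) = d k" for k
      using e d(1)[of k] by (intro f_inv_into_f) (auto simp: bij_betw_def)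
    then have "F (\<lambda>k. inv e (d k)) = x" using d(2) by (simp add: F_def sums_iff)
    then show ?thesis by blast
  qed
  have lower: "ennreal (1 / (2 * K)) \<le> (\<Sum>i. ennreal (diameter (C i) powr s))"
    if cover: "range P \<subseteq> (\<Union>i. C i)" and C: "\<And>i. bounded (C i)" "\<And>i. diameter (C i) \<le> 1" for C :: "nat \<Rightarrow> 'a set"
  proof -
    \<comment> \<open>A centre taken from the values of \<open>F\<close> on codes landing in
      \<open>C i\<close>. If there are none the choice is arbitrary and harmless: \<open>I i\<close>
      is only required to cover values of such codes.\<close>
    define z where "z i = F (SOME c. P c \<in> C i)" for i
    define I where "I i = {z i - K * diameter (C i) powr h..z i + K * diameter (C i) powr h}" for i
    have "{0..<1} \<subseteq> (\<Union>i. I i)"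
    proof
      fix x :: real assume "x \<in> {0..<1}"
      then obtain c where c: "F c = x" using surj by auto
      obtain i where i: "P c \<in> C i" using cover by blast
      then have "P (SOME c. P c \<in> C i) \<in> C i" by (rule someI[where P = "\<lambda>c. P c \<in> C i"])
      then have "dist (P c) (P (SOME c. P c \<in> C i)) \<le> diameter (C i)"
        using i C(1) by (intro diameter_bounded_bound)
      then have "\<bar>F c - z i\<bar> \<le> K * diameter (C i) powr h"
        unfolding z_def using K h by (intro order_trans[OF F_dist] mult_left_mono powr_mono2) auto
      then show "x \<in> (\<Union>i. I i)" using c by (auto simp: I_def intro!: exI[of _ i])
    qed
    then have "emeasure lborel {0..<1::real} \<le> emeasure lborel (\<Union>i. I i)"
      by (intro emeasure_mono) (auto simp: I_def)
    also have "\<dots> \<le> (\<Sum>i. emeasure lborel (I i))"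
      by (intro emeasure_subadditive_countably) (auto simp: I_def)
    also have "\<dots> = (\<Sum>i. ennreal (2 * K) * ennreal (diameter (C i) powr h))"
      using K by (intro suminf_cong) (simp add: I_def flip: ennreal_mult)
    also have "\<dots> = ennreal (2 * K) * (\<Sum>i. ennreal (diameter (C i) powr h))" by simp
    also have "\<dots> \<le> ennreal (2 * K) * (\<Sum>i. ennreal (diameter (C i) powr s))"
    proof (intro mult_left_mono suminf_le ennreal_leI)
      \<comment> \<open>Diameters at most 1 are needed to pass from exponent \<open>h\<close> down
        to \<open>s\<close>, which is why the scale 1 is used below.\<close>
      show "diameter (C i) powr h \<le> diameter (C i) powr s" for i
        using C[of i] diameter_ge_0[of "C i"] s by (cases "diameter (C i) = 0") (auto intro: powr_mono')
    qed auto
    finally have "1 \<le> ennreal (2 * K) * (\<Sum>i. ennreal (diameter (C i) powr s))" by simp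
    then have "ennreal (1 / (2 * K)) * 1 \<le> ennreal (1 / (2 * K)) * (ennreal (2 * K) * (\<Sum>i. ennreal (diameter (C i) powr s)))"
      by (rule mult_left_mono) simp
    also have "\<dots> = (\<Sum>i. ennreal (diameter (C i) powr s))"
      using K by (simp flip: mult.assoc ennreal_mult)
    finally show ?thesis by simp
  qed
  have "0 < ennreal (1 / (2 * K))" using K by simp
  also have "\<dots> \<le> hausdorff_pre s 1 (range P)"
    unfolding hausdorff_pre_def by (intro INF_greatest) (use lower in auto)
  also have "\<dots> \<le> hausdorff_measure s (range P)"
    unfolding hausdorff_measure_def by (intro SUP_upper) simp
  finally show ?thesis by simp
qed

text \<open>At \<open>h\<close> the number of cylinders exactly balances their size. Any larger
  exponent makes the covering cost decay, and every exponent up to \<open>h\<close> leaves positive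
  measure.\<close>

theorem hausdorff_dim_range:
  fixes P :: "(nat \<Rightarrow> 'd::finite) \<Rightarrow> 'a::real_normed_vector"
  assumes upper: "\<And>c c' n. (\<And>k. k < n \<Longrightarrow> c k = c' k) \<Longrightarrow> dist (P c) (P c') \<le> A * r ^ n"
    and lower: "\<And>c c' n. (\<And>k. k < n \<Longrightarrow> c k = c' k) \<Longrightarrow> c n \<noteq> c' n \<Longrightarrow> B * r ^ n \<le> dist (P c) (P c')"
    and B: "0 < B" and r: "0 < r" "r < 1" and h: "0 < h" "CARD('d) * r powr h = 1"
    and card: "2 \<le> CARD('d)"
  shows "hausdorff_dim (range P) = ereal h"
  unfolding hausdorff_dim_def
proof (rule antisym)
  show "(INF s\<in>{s. 0 \<le> s \<and> hausdorff_measure s (range P) = 0}. ereal s) \<le> ereal h"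
  proof (rule ereal_le_epsilon2)
    fix \<epsilon> :: real assume \<epsilon>: "0 < \<epsilon>"
    have "r powr (h + \<epsilon>) < r powr h" using r \<epsilon> by (intro powr_less_mono') auto
    then have "CARD('d) * r powr (h + \<epsilon>) < CARD('d) * r powr h"
      using card by (intro mult_strict_left_mono) auto
    then have "hausdorff_measure (h + \<epsilon>) (range P) = 0"
      using h \<epsilon> by (intro hausdorff_measure_range_eq_0[OF upper r]) auto
    then show "(INF s\<in>{s. 0 \<le> s \<and> hausdorff_measure s (range P) = 0}. ereal s) \<le> ereal h + ereal \<epsilon>"
      using h \<epsilon> by (intro INF_lower2[of "h + \<epsilon>"]) auto
  qed
  show "ereal h \<le> (INF s\<in>{s. 0 \<le> s \<and> hausdorff_measure s (range P) = 0}. ereal s)"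
  proof (rule INF_greatest)
    fix s assume s: "s \<in> {s. 0 \<le> s \<and> hausdorff_measure s (range P) = 0}"
    have "hausdorff_measure s (range P) \<noteq> 0" if "s \<le> h"
      using lower B r(1) h card _ that by (rule hausdorff_measure_range_pos) (use s in auto)
    then show "ereal h \<le> ereal s" using s by force
  qed
qed

section \<open>Digit sums with lacunary weights\<close>

text \<open>Samples with different values are at least \<open>\<eta>\<close> apart, so
  \<open>v\<close> is a Lipschitz function of \<open>p\<close>. This is how a shear profile with
  prescribed values on a Cantor set is obtained.\<close>

lemma lipschitz_extension_of_separated:
  fixes p v :: "'c \<Rightarrow> real"
  assumes sep: "\<And>c c'. v c \<noteq> v c' \<Longrightarrow> \<eta> \<le> \<bar>p c - p c'\<bar>"
    and \<eta>: "0 < \<eta>" and M: "\<And>c. \<bar>v c\<bar> \<le> M"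
  obtains f L where "L-lipschitz_on UNIV f" "\<And>u. \<bar>f u\<bar> \<le> M" "\<And>c. f (p c) = v c"
proof -
  \<comment> \<open>Values differ by at most \<open>2 * M\<close>, and only over distances of at
    least \<open>\<eta>\<close>.\<close>
  define K where "K = 2 * M / \<eta>"
  have M0: "0 \<le> M" using M[of undefined] by linarith
  have K: "0 \<le> K" using M0 \<eta> by (simp add: K_def)
  have vK: "v c \<le> v c' + K * \<bar>p c - p c'\<bar>" for c c'
  proof (cases "v c = v c'")
    case False
    have "2 * M = K * \<eta>" using \<eta> by (simp add: K_def)
    also have "\<dots> \<le> K * \<bar>p c - p c'\<bar>" using sep[OF False] K by (rule mult_left_mono)
    finally show ?thesis using M[of c] M[of c'] by linarith
  qed (use K in simp)
  \<comment> \<open>McShane's extension, truncated to keep the bound.\<close>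
  define g where "g u = (INF c. v c + K * \<bar>u - p c\<bar>)" for u
  have bdd: "bdd_below (range (\<lambda>c. v c + K * \<bar>u - p c\<bar>))" for u
  proof (rule bdd_belowI2)
    show "- M \<le> v c + K * \<bar>u - p c\<bar>" for c using M[of c] mult_nonneg_nonneg[OF K, of "\<bar>u - p c\<bar>"] by linarith
  qed
  have g_le: "g u \<le> g t + K * \<bar>u - t\<bar>" for u t
  proof -
    have "g u - K * \<bar>u - t\<bar> \<le> g t"
      unfolding g_def[of t]
    proof (rule cINF_greatest)
      fix c
      have "g u \<le> v c + K * \<bar>u - p c\<bar>" unfolding g_def by (rule cINF_lower[OF bdd]) simp
      also have "K * \<bar>u - p c\<bar> \<le> K * (\<bar>u - t\<bar> + \<bar>t - p c\<bar>)" using K by (intro mult_left_mono) auto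
      finally show "g u - K * \<bar>u - t\<bar> \<le> v c + K * \<bar>t - p c\<bar>" by (simp add: algebra_simps)
    qed simp
    then show ?thesis by simp
  qed
  have g_eq: "g (p c) = v c" for c
  proof (rule antisym)
    have "g (p c) \<le> v c + K * \<bar>p c - p c\<bar>" unfolding g_def by (rule cINF_lower[OF bdd]) simp
    then show "g (p c) \<le> v c" by simp
    show "v c \<le> g (p c)" unfolding g_def by (rule cINF_greatest) (auto simp: vK)
  qed
  define f where "f u = max (- M) (min M (g u))" for u
  have "K-lipschitz_on UNIV f"
  proof (rule lipschitz_onI)
    fix u t :: real
    have "\<bar>f u - f t\<bar> \<le> \<bar>g u - g t\<bar>" unfolding f_def by linarith
    also have "\<dots> \<le> K * \<bar>u - t\<bar>" using g_le[of u t] g_le[of t u] by (simp add: abs_minus_commute abs_le_iff)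
    finally show "dist (f u) (f t) \<le> K * dist u t" by (simp add: dist_real_def)
  qed (rule K)
  moreover have "\<bar>f u\<bar> \<le> M" for u using M0 by (auto simp: f_def)
  moreover have "f (p c) = v c" for c using M[of c] by (simp add: f_def g_eq)
  ultimately show ?thesis using that by blast
qed

section \<open>Reading digits off a lacunary sum\<close>

definition digit_sum :: "(nat \<Rightarrow> real) \<Rightarrow> (nat \<Rightarrow> bool) \<Rightarrow> real" where
  "digit_sum s a = (\<Sum>k. s k * of_bool (a k))"

text \<open>As \<open>q > 2\<close>, all weights after \<open>s k\<close> sum to at most
  \<open>s k / (q - 1) < s k\<close>, so later digits cannot compensate for a difference in digit
  \<open>k\<close>.\<close>

locale lacunary =
  fixes q :: real and s :: "nat \<Rightarrow> real"
  assumes q: "2 < q" and pos: "0 < s k" and decay: "q * s (Suc k) \<le> s k"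
begin

lemma geometric_bound: "s (i + k) \<le> s k * (1 / q) ^ i"
proof (induction i)
  case (Suc i)
  have "s (Suc i + k) \<le> s (i + k) / q" using decay[of "i + k"] q by (simp add: pos_le_divide_eq mult.commute)
  also have "\<dots> \<le> s k * (1 / q) ^ i / q" using Suc q by (intro divide_right_mono) auto
  finally show ?case by simp
qed simp

lemma summable_tail: "summable (\<lambda>i. s (i + k))" and tail_le: "(\<Sum>i. s (i + k)) \<le> s k * (q / (q - 1))"
proof -
  have geo: "(\<lambda>i. s k * (1 / q) ^ i) sums (s k * (1 / (1 - 1 / q)))"
    using q by (intro sums_mult geometric_sums) simp
  show sm: "summable (\<lambda>i. s (i + k))"
    by (rule summable_comparison_test'[OF sums_summable[OF geo]]) (use geometric_bound[of _ k] pos in \<open>simp add: less_imp_le\<close>)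
  have "(\<Sum>i. s (i + k)) \<le> (\<Sum>i. s k * (1 / q) ^ i)"
    by (intro suminf_le geometric_bound sm sums_summable[OF geo])
  also have "\<dots> = s k * (q / (q - 1))" using geo q by (simp add: sums_iff field_simps)
  finally show "(\<Sum>i. s (i + k)) \<le> s k * (q / (q - 1))" .
qed

lemma tail_le_2: "(\<Sum>i. s (i + k)) \<le> 2 * s k"
proof -
  have "q / (q - 1) \<le> 2" using q by (simp add: divide_le_eq)
  then have "s k * (q / (q - 1)) \<le> s k * 2" using pos[of k] by (intro mult_left_mono) auto
  then show ?thesis using tail_le[of k] by linarith
qed

lemma antimono: "i \<le> j \<Longrightarrow> s j \<le> s i"
proof (rule lift_Suc_antimono_le)
  show "s (Suc n) \<le> s n" for n
  proof -
    have "1 * s (Suc n) \<le> q * s (Suc n)" using q pos[of "Suc n"] by (intro mult_right_mono) auto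
    then show ?thesis using decay[of n] by linarith
  qed
qed

lemma summable_digits: "summable (\<lambda>k. s k * of_bool (a k))"
  by (rule summable_comparison_test'[of s 0])
    (use summable_tail[of 0] pos in \<open>auto simp: of_bool_def less_imp_le\<close>)

lemma digit_sum_bounds: "0 \<le> digit_sum s a" "digit_sum s a \<le> 2 * s 0"
proof -
  show "0 \<le> digit_sum s a"
    unfolding digit_sum_def using pos by (intro suminf_nonneg summable_digits) (simp add: less_imp_le)
  have "digit_sum s a \<le> (\<Sum>k. s (k + 0))"
    unfolding digit_sum_def using pos by (intro suminf_le summable_digits summable_tail) (auto simp: of_bool_def less_imp_le)
  then show "digit_sum s a \<le> 2 * s 0" using tail_le_2[of 0] by linarith
qed

lemma digit_sum_diff:
  assumes "\<And>i. i < n \<Longrightarrow> a i = b i"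
  defines "u \<equiv> \<lambda>i. s i * (of_bool (a i) - of_bool (b i))"
  shows "summable u" "digit_sum s a - digit_sum s b = (\<Sum>i. u (i + n))" "\<bar>\<Sum>i. u (i + m)\<bar> \<le> (\<Sum>i. s (i + m))"
proof -
  have u: "u = (\<lambda>i. s i * of_bool (a i) - s i * of_bool (b i))" by (simp add: u_def right_diff_distrib)
  show su: "summable u" unfolding u by (intro summable_diff summable_digits)
  have "digit_sum s a - digit_sum s b = suminf u" unfolding digit_sum_def u by (intro suminf_diff summable_digits)
  also have "\<dots> = (\<Sum>i. u (i + n))"
    using suminf_split_initial_segment[OF su, of n] assms(1) by (simp add: u_def)
  finally show "digit_sum s a - digit_sum s b = (\<Sum>i. u (i + n))" .
  have "norm (u i) \<le> s i" for i using pos[of i] by (auto simp: u_def of_bool_def)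
  then show "\<bar>\<Sum>i. u (i + m)\<bar> \<le> (\<Sum>i. s (i + m))"
    using norm_suminf_le[of "\<lambda>i. u (i + m)" "\<lambda>i. s (i + m)"] summable_tail by simp
qed

lemma digit_sum_close:
  assumes "\<And>i. i < n \<Longrightarrow> a i = b i"
  shows "\<bar>digit_sum s a - digit_sum s b\<bar> \<le> 2 * s n"
  using digit_sum_diff(2)[of n a b] digit_sum_diff(3)[of n a b n] tail_le_2[of n] assms by simp

text \<open>At the first differing place \<open>n \<le> k\<close> the sums separate by
  \<open>s n\<close>, and the tail takes back at most \<open>s n / (q - 1)\<close>. What remains is
  \<open>(q - 2) / (q - 1) * s n\<close>, and \<open>s k \<le> s n\<close>.\<close>

lemma digit_sum_gap:
  assumes "a k \<noteq> b k"
  shows "(q - 2) / (q - 1) * s k \<le> \<bar>digit_sum s a - digit_sum s b\<bar>"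
proof -
  have "a \<noteq> b" using assms by auto
  then obtain n where n: "\<And>i. i < n \<Longrightarrow> a i = b i" "a n \<noteq> b n" using first_difference by blast
  have "n \<le> k" using n(1)[of k] assms by (meson not_le)
  define u where "u i = s i * (of_bool (a i) - of_bool (b i))" for i
  have su: "summable (\<lambda>i. u (i + n))"
    unfolding u_def using digit_sum_diff(1)[of n a b] n(1) by (intro summable_ignore_initial_segment) simp
  have "digit_sum s a - digit_sum s b = u n + (\<Sum>i. u (i + Suc n))"
    using digit_sum_diff(2)[of n a b] n(1) suminf_split_head[OF su] by (simp add: u_def)
  moreover have "\<bar>u n\<bar> = s n" using n(2) pos[of n] by (auto simp: u_def of_bool_def)
  moreover have "\<bar>\<Sum>i. u (i + Suc n)\<bar> \<le> s n * (1 / (q - 1))"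
  proof -
    have "\<bar>\<Sum>i. u (i + Suc n)\<bar> \<le> (\<Sum>i. s (i + Suc n))"
      using digit_sum_diff(3)[of n a b "Suc n"] n(1) by (simp add: u_def)
    also have "\<dots> \<le> s (Suc n) * q * (1 / (q - 1))" using tail_le[of "Suc n"] by simp
    also have "\<dots> \<le> s n * (1 / (q - 1))" using decay[of n] q by (intro mult_right_mono) (auto simp: mult.commute)
    finally show ?thesis .
  qed
  ultimately have "s n - s n * (1 / (q - 1)) \<le> \<bar>digit_sum s a - digit_sum s b\<bar>" by linarith
  moreover have "s n - s n * (1 / (q - 1)) = (q - 2) / (q - 1) * s n" using q by (simp add: field_simps)
  moreover have "(q - 2) / (q - 1) * s k \<le> (q - 2) / (q - 1) * s n"
    using antimono[OF \<open>n \<le> k\<close>] q by (intro mult_left_mono) auto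
  ultimately show ?thesis by linarith
qed

text \<open>Digit sums lie in an interval of length \<open>2 * s 0\<close>, so different lifts leave
  a distance of at least \<open>4 * s 0\<close>; equal lifts cancel.\<close>

lemma lifted_digit_sum_gap:
  assumes V: "6 * s 0 \<le> V" and ne: "a k \<noteq> b k \<or> x \<noteq> y"
  shows "(q - 2) / (q - 1) * s k \<le> \<bar>(digit_sum s a + V * of_bool x) - (digit_sum s b + V * of_bool y)\<bar>"
proof (cases "x = y")
  case True
  then show ?thesis using digit_sum_gap[of a k b] ne by simp
next
  case False
  have "(q - 2) / (q - 1) \<le> 1" using q by simp
  then have "(q - 2) / (q - 1) * s k \<le> 1 * s k" using pos[of k] by (intro mult_right_mono) auto
  moreover have "s k \<le> s 0" by (rule antimono) simp
  moreover have "\<bar>V * of_bool x - V * of_bool y\<bar> = V" using False V pos[of 0] by (auto simp: of_bool_def)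
  ultimately show ?thesis using digit_sum_bounds[of a] digit_sum_bounds[of b] V pos[of 0] by linarith
qed

lemma digit_sum_fun_upd:
  "digit_sum (s(k := \<rho> * s k)) a = digit_sum s a - (1 - \<rho>) * s k * of_bool (a k)"
proof -
  have "(\<lambda>i. s i * of_bool (a i) - (if i = k then (1 - \<rho>) * s k * of_bool (a k) else 0))
      sums (digit_sum s a - (1 - \<rho>) * s k * of_bool (a k))"
    unfolding digit_sum_def by (intro sums_diff summable_sums summable_digits sums_single)
  also have "(\<lambda>i. s i * of_bool (a i) - (if i = k then (1 - \<rho>) * s k * of_bool (a k) else 0))
      = (\<lambda>i. (s(k := \<rho> * s k)) i * of_bool (a i))"
    by (auto simp: fun_eq_iff algebra_simps)
  finally show ?thesis by (simp add: digit_sum_def sums_iff)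
qed

end

section \<open>Shrinking the digit weights by shears\<close>

definition x_sum :: "(nat \<Rightarrow> real) \<Rightarrow> (nat \<Rightarrow> bool \<times> bool) \<Rightarrow> real" where "x_sum s c = digit_sum s (\<lambda>k. fst (c k))"
definition y_sum :: "(nat \<Rightarrow> real) \<Rightarrow> (nat \<Rightarrow> bool \<times> bool) \<Rightarrow> real" where "y_sum s c = digit_sum s (\<lambda>k. snd (c k))"

text \<open>Four shears multiply one digit weight by \<open>\<rho>\<close> in both coordinates. The first two
  lift the points with digit 1 clear of the others, so that the next shear, in the other direction, can
  tell them apart; the last two undo the lifts.\<close>

lemma shrink_digit_by_shears:
  assumes s: "lacunary q s" and s': "lacunary q (s(k := \<rho> * s k))" and \<rho>: "0 < \<rho>" "\<rho> < 1"
  defines "s' \<equiv> s(k := \<rho> * s k)"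
  shows "\<exists>(F :: nat \<Rightarrow> real \<Rightarrow> real) L. (\<forall>i. (L i)-lipschitz_on UNIV (F i) \<and> (\<forall>u. \<bar>F i u\<bar> \<le> 7 * s 0)) \<and>
    (\<forall>c. y_sum s' c = y_sum s c + F 0 (x_sum s c) + F 2 (x_sum s c + F 1 (y_sum s c + F 0 (x_sum s c))) \<and>
         x_sum s' c = x_sum s c + F 1 (y_sum s c + F 0 (x_sum s c)) + F 3 (y_sum s' c))"
proof -
  interpret s: lacunary q s by (rule s)
  interpret s': lacunary q s' using s' by (simp add: s'_def)
  \<comment> \<open>\<open>V\<close> is the height of the lifts and \<open>\<delta>\<close> the
    amount by which a digit 1 has to move. Every displacement is at most
    \<open>V + \<delta> \<le> 7 * s 0\<close>.\<close>
  define V where "V = 6 * s 0"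
  define \<delta> where "\<delta> = (1 - \<rho>) * s k"
  \<comment> \<open>Formed with the smaller weight \<open>s' k\<close>, so that one gap serves the
    sums before and after shrinking.\<close>
  define \<eta> where "\<eta> = (q - 2) / (q - 1) * s' k"
  have \<eta>: "0 < \<eta>" using s.q s'.pos[of k] by (simp add: \<eta>_def)
  have \<eta>_le: "\<eta> \<le> (q - 2) / (q - 1) * s k"
    unfolding \<eta>_def using s.q s.pos[of k] \<rho> by (intro mult_left_mono) (auto simp: s'_def)
  have s'_0: "s' 0 \<le> s 0" using s.pos[of 0] \<rho> by (simp add: s'_def)
  then have V: "6 * s 0 \<le> V" "6 * s' 0 \<le> V" by (simp_all add: V_def)
  have "(1 - \<rho>) * s k \<le> 1 * s k" using \<rho> s.pos[of k] by (intro mult_right_mono) auto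
  then have \<delta>: "0 \<le> \<delta>" "\<delta> \<le> s 0"
    using \<rho> s.pos[of k] order_trans[OF _ s.antimono[of 0 k], of "(1 - \<rho>) * s k"] by (simp_all add: \<delta>_def)
  let ?a = "\<lambda>c::nat \<Rightarrow> bool \<times> bool. fst (c k)" and ?b = "\<lambda>c::nat \<Rightarrow> bool \<times> bool. snd (c k)"
  have s'_eq: "x_sum s' c = x_sum s c - \<delta> * of_bool (?a c)" "y_sum s' c = y_sum s c - \<delta> * of_bool (?b c)" for c
    using s.digit_sum_fun_upd by (simp_all add: x_sum_def y_sum_def s'_def \<delta>_def)
  have gap: "\<eta> \<le> \<bar>(digit_sum t d + V * of_bool x) - (digit_sum t e + V * of_bool y)\<bar>"
    if "t \<in> {s, s'}" "d k \<noteq> e k \<or> x \<noteq> y" for t d e x y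
    using that s.lifted_digit_sum_gap[OF V(1), of d k e x y] s'.lifted_digit_sum_gap[OF V(2), of d k e x y] \<eta>_le
    by (auto simp: \<eta>_def)
  have gap0: "\<eta> \<le> \<bar>digit_sum t d - digit_sum t e\<bar>" if "t \<in> {s, s'}" "d k \<noteq> e k" for t d e
    using gap[of t d e False False] that by simp
  \<comment> \<open>Reads the first digit from \<open>x\<close> and lifts \<open>y\<close> by
    it.\<close>
  obtain f0 L0 where f0: "L0-lipschitz_on UNIV f0" "\<And>u. \<bar>f0 u\<bar> \<le> 7 * s 0" "\<And>c. f0 (x_sum s c) = V * of_bool (?a c)"
  proof (rule lipschitz_extension_of_separated[of "\<lambda>c. V * of_bool (?a c)" \<eta> "x_sum s" "7 * s 0"])
    show "\<eta> \<le> \<bar>x_sum s c - x_sum s c'\<bar>" if "V * of_bool (?a c) \<noteq> V * of_bool (?a c')" for c c'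
      unfolding x_sum_def using that by (intro gap0) auto
  qed (use \<eta> V s.pos[of 0] in \<open>auto simp: V_def of_bool_def\<close>)
  \<comment> \<open>The lifted \<open>y\<close> reveals both digits, so one shear can shrink
    \<open>x\<close> using the first digit and lift it using the second.\<close>
  obtain f1 L1 where f1: "L1-lipschitz_on UNIV f1" "\<And>u. \<bar>f1 u\<bar> \<le> 7 * s 0"
    "\<And>c. f1 (y_sum s c + V * of_bool (?a c)) = V * of_bool (?b c) - \<delta> * of_bool (?a c)"
  proof (rule lipschitz_extension_of_separated[of "\<lambda>c. V * of_bool (?b c) - \<delta> * of_bool (?a c)" \<eta> "\<lambda>c. y_sum s c + V * of_bool (?a c)" "7 * s 0"])
    show "\<eta> \<le> \<bar>(y_sum s c + V * of_bool (?a c)) - (y_sum s c' + V * of_bool (?a c'))\<bar>"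
      if "V * of_bool (?b c) - \<delta> * of_bool (?a c) \<noteq> V * of_bool (?b c') - \<delta> * of_bool (?a c')" for c c'
      unfolding y_sum_def using that by (intro gap) auto
  qed (use \<eta> \<delta> s.pos[of 0] in \<open>auto simp: V_def of_bool_def\<close>)
  \<comment> \<open>Now the shrunk and lifted \<open>x\<close> reveals both digits: the lift of
    \<open>y\<close> is undone and \<open>y\<close> is shrunk.\<close>
  obtain f2 L2 where f2: "L2-lipschitz_on UNIV f2" "\<And>u. \<bar>f2 u\<bar> \<le> 7 * s 0"
    "\<And>c. f2 (x_sum s' c + V * of_bool (?b c)) = - V * of_bool (?a c) - \<delta> * of_bool (?b c)"
  proof (rule lipschitz_extension_of_separated[of "\<lambda>c. - V * of_bool (?a c) - \<delta> * of_bool (?b c)" \<eta> "\<lambda>c. x_sum s' c + V * of_bool (?b c)" "7 * s 0"])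
    show "\<eta> \<le> \<bar>(x_sum s' c + V * of_bool (?b c)) - (x_sum s' c' + V * of_bool (?b c'))\<bar>"
      if "- V * of_bool (?a c) - \<delta> * of_bool (?b c) \<noteq> - V * of_bool (?a c') - \<delta> * of_bool (?b c')" for c c'
      unfolding x_sum_def using that by (intro gap) auto
  qed (use \<eta> \<delta> s.pos[of 0] in \<open>auto simp: V_def of_bool_def\<close>)
  \<comment> \<open>The shrunk \<open>y\<close> still shows the second digit, which suffices to undo
    the lift of \<open>x\<close>.\<close>
  obtain f3 L3 where f3: "L3-lipschitz_on UNIV f3" "\<And>u. \<bar>f3 u\<bar> \<le> 7 * s 0" "\<And>c. f3 (y_sum s' c) = - V * of_bool (?b c)"
  proof (rule lipschitz_extension_of_separated[of "\<lambda>c. - V * of_bool (?b c)" \<eta> "y_sum s'" "7 * s 0"])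
    show "\<eta> \<le> \<bar>y_sum s' c - y_sum s' c'\<bar>" if "- V * of_bool (?b c) \<noteq> - V * of_bool (?b c')" for c c'
      unfolding y_sum_def using that by (intro gap0) auto
  qed (use \<eta> V s.pos[of 0] in \<open>auto simp: V_def of_bool_def\<close>)
  define F where "F i = (if i = 0 then f0 else if i = 1 then f1 else if i = 2 then f2 else f3)" for i :: nat
  define L where "L i = (if i = 0 then L0 else if i = 1 then L1 else if i = 2 then L2 else L3)" for i :: nat
  have bounds: "(L i)-lipschitz_on UNIV (F i) \<and> (\<forall>u. \<bar>F i u\<bar> \<le> 7 * s 0)" for i
    using f0 f1 f2 f3 by (simp add: F_def L_def)
  have moves: "y_sum s' c = y_sum s c + F 0 (x_sum s c) + F 2 (x_sum s c + F 1 (y_sum s c + F 0 (x_sum s c))) \<and>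
         x_sum s' c = x_sum s c + F 1 (y_sum s c + F 0 (x_sum s c)) + F 3 (y_sum s' c)" for c
  proof -
    have 0: "F 0 (x_sum s c) = V * of_bool (?a c)" by (simp add: F_def f0)
    have 1: "F 1 (y_sum s c + V * of_bool (?a c)) = V * of_bool (?b c) - \<delta> * of_bool (?a c)" by (simp add: F_def f1)
    have 2: "F 2 (x_sum s c + (V * of_bool (?b c) - \<delta> * of_bool (?a c))) = - V * of_bool (?a c) - \<delta> * of_bool (?b c)"
      using f2(3)[of c] by (simp add: F_def s'_eq(1) algebra_simps)
    have 3: "F 3 (y_sum s' c) = - V * of_bool (?b c)" by (simp add: F_def f3)
    show ?thesis unfolding 0 1 2 3 by (simp add: s'_eq)
  qed
  show ?thesis
    using bounds moves by blast
qed

text \<open>Stage \<open>n\<close> shrinks digits \<open>n, n - 1, \<dots>, 0\<close> in this order, one per step; the Cantor pairing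
  enumerates the steps. Going downwards keeps every intermediate weight sequence lacunary.\<close>

primrec schedule :: "real \<Rightarrow> real \<Rightarrow> nat \<Rightarrow> nat \<Rightarrow> real" where
  "schedule q r 0 = (\<lambda>k. r ^ k)"
| "schedule q r (Suc m) = (schedule q r m)(snd (prod_decode m) := q * r * schedule q r m (snd (prod_decode m)))"

definition stage :: "nat \<Rightarrow> nat" where "stage m = fst (prod_decode m) + snd (prod_decode m)"

lemma prod_decode_Suc:
  "prod_decode (Suc m) = (case prod_decode m of (a, 0) \<Rightarrow> (0, Suc a) | (a, Suc b) \<Rightarrow> (Suc a, b))"
proof -
  obtain a b where ab: "prod_decode m = (a, b)" by fastforce
  then have m: "m = prod_encode (a, b)" using prod_decode_inverse[of m] by simp
  have "Suc m = prod_encode (case b of 0 \<Rightarrow> (0, Suc a) | Suc b' \<Rightarrow> (Suc a, b'))"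
    by (cases b) (simp_all add: m prod_encode_def)
  then show ?thesis unfolding ab by (simp split: nat.split)
qed

text \<open>Digit \<open>k\<close> first takes part in stage \<open>k\<close>. Before step
  \<open>m\<close> it has been shrunk once in each completed stage from \<open>k\<close> on, which
  truncated subtraction counts as \<open>stage m - k\<close>, and once more if the current downward
  pass has already gone by it.\<close>

lemma schedule_eq:
  "schedule q r m k = r ^ k * (q * r) ^ (stage m - k + of_bool (snd (prod_decode m) < k \<and> k \<le> stage m))"
proof (induction m arbitrary: k)
  case 0
  have "prod_decode 0 = (0, 0)" using prod_encode_inverse[of "(0, 0)"] by (simp add: prod_encode_def)
  then show ?case by (simp add: stage_def)
next
  case (Suc m)
  obtain a b where ab: "prod_decode m = (a, b)" by fastforce
  show ?case
  proof (cases b)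
    case 0
    then show ?thesis using Suc ab
      by (auto simp: stage_def prod_decode_Suc of_bool_def Suc_diff_le mult_ac)
  next
    case (Suc b')
    then show ?thesis using Suc.IH ab
      by (auto simp: stage_def prod_decode_Suc of_bool_def mult_ac)
  qed
qed

lemma lacunary_schedule:
  assumes "2 < q" "0 < r" "q * r < 1"
  shows "lacunary q (schedule q r m)"
proof
  fix k
  define e where "e k = stage m - k + of_bool (snd (prod_decode m) < k \<and> k \<le> stage m)" for k
  have qr: "0 < q * r" using assms by simp
  show "0 < schedule q r m k" using assms qr by (simp add: schedule_eq)
  \<comment> \<open>Digit \<open>k\<close> is at most one shrinking ahead of digit
    \<open>k + 1\<close>: it joins one stage earlier, but comes later within each common stage. The
    spare factor \<open>q * r\<close> between \<open>r ^ Suc k\<close> and \<open>r ^ k\<close> pays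
    for this.\<close>
  have "e k \<le> Suc (e (Suc k))" by (auto simp: e_def of_bool_def)
  then have "(q * r) ^ Suc (e (Suc k)) \<le> (q * r) ^ e k" using assms qr by (intro power_decreasing) auto
  then have "r ^ k * (q * r) ^ Suc (e (Suc k)) \<le> r ^ k * (q * r) ^ e k" using assms by (intro mult_left_mono) auto
  then show "q * schedule q r m (Suc k) \<le> schedule q r m k" by (simp add: schedule_eq mult_ac flip: e_def)
qed (rule assms)

lemma schedule_0: "schedule q r m 0 = (q * r) ^ stage m"
  by (simp add: schedule_eq)

text \<open>\<open>stage\<close> adds the two decoded indices, so partial sums are dominated by a
  product of two geometric series.\<close>

lemma summable_power_stage:
  fixes \<sigma> :: real
  assumes "0 < \<sigma>" "\<sigma> < 1"
  shows "summable (\<lambda>m. \<sigma> ^ stage m)"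
proof (rule summableI_nonneg_bounded)
  fix N
  have sub: "prod_decode ` {..<N} \<subseteq> {..<N} \<times> {..<N}"
  proof
    fix p assume "p \<in> prod_decode ` {..<N}"
    then have "prod_encode p < N" by auto
    then show "p \<in> {..<N} \<times> {..<N}"
      using le_prod_encode_1[of "fst p" "snd p"] le_prod_encode_2[of "snd p" "fst p"] by (cases p) auto
  qed
  have "(\<Sum>m<N. \<sigma> ^ stage m) = (\<Sum>(a, b)\<in>prod_decode ` {..<N}. \<sigma> ^ a * \<sigma> ^ b)"
    by (subst sum.reindex) (auto simp: inj_prod_decode stage_def power_add case_prod_unfold)
  also have "\<dots> \<le> (\<Sum>(a, b)\<in>{..<N} \<times> {..<N}. \<sigma> ^ a * \<sigma> ^ b)"
    using assms by (intro sum_mono2 sub) auto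
  also have "\<dots> = (\<Sum>a<N. \<sigma> ^ a) * (\<Sum>b<N. \<sigma> ^ b)"
    by (simp add: sum_product sum.cartesian_product)
  also have "\<dots> \<le> (1 / (1 - \<sigma>)) * (1 / (1 - \<sigma>))"
    using assms suminf_geometric[of \<sigma>] sum_le_suminf[OF summable_geometric, of \<sigma> "{..<N}"]
    by (intro mult_mono) (auto intro!: sum_nonneg)
  finally show "(\<Sum>m<N. \<sigma> ^ stage m) \<le> (1 / (1 - \<sigma>)) * (1 / (1 - \<sigma>))" .
qed (use assms in simp)

text \<open>Every term is repeated \<open>d\<close> times; used with \<open>d = 4\<close>, for the
  four shears of one step.\<close>

lemma summable_div:
  fixes g :: "nat \<Rightarrow> real"
  assumes g: "summable g" "\<And>m. 0 \<le> g m" and d: "0 < d"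
  shows "summable (\<lambda>p. g (p div d))"
proof (rule summableI_nonneg_bounded)
  fix n
  have "(\<Sum>p<n. g (p div d)) \<le> (\<Sum>p<n * d. g (p div d))"
    using g d by (intro sum_mono2) auto
  also have "\<dots> = (\<Sum>m<n. \<Sum>p\<in>{m * d..<m * d + d}. g (p div d))"
    by (rule sum.nat_group[symmetric])
  also have "\<dots> = (\<Sum>m<n. real d * g m)"
  proof (rule sum.cong[OF refl])
    fix m
    have "g (p div d) = g m" if "p \<in> {m * d..<m * d + d}" for p
    proof -
      have "p div d = m" using that by (intro div_nat_eqI) (auto simp: mult.commute)
      then show ?thesis by simp
    qed
    then show "(\<Sum>p\<in>{m * d..<m * d + d}. g (p div d)) = real d * g m" by simp
  qed
  also have "\<dots> \<le> real d * suminf g"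
    unfolding sum_distrib_left[symmetric] using g by (intro mult_left_mono sum_le_suminf) auto
  finally show "(\<Sum>p<n. g (p div d)) \<le> real d * suminf g" .
qed (use g in simp)

section \<open>The Cantor set and its bi-Lipschitz images\<close>

definition code_point :: "(nat \<Rightarrow> real) \<Rightarrow> (nat \<Rightarrow> bool \<times> bool) \<Rightarrow> real^2" where
  "code_point s c = vector [x_sum s c, y_sum s c]"

lemma dist_vector_2:
  "\<bar>x $ i - y $ i\<bar> \<le> dist x y" "dist x y \<le> \<bar>x $ 1 - y $ 1\<bar> + \<bar>x $ 2 - y $ 2\<bar>" for x y :: "real^2"
  using component_le_norm_cart[of "x - y" i] norm_le_l1_cart[of "x - y"] by (simp_all add: dist_norm sum_2)

text \<open>Tychonoff's theorem, a finite factor being compact. It makes the Cantor set compact as a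
  continuous image of the code space.\<close>

lemma compact_UNIV_fun:
  "compact (UNIV :: ('i \<Rightarrow> 'a::{topological_space, finite}) set)"
proof -
  have "compact_space (euclidean :: 'a topology)"
    by (simp add: compact_space_def finite_imp_compact)
  then have "compact_space (product_topology (\<lambda>_::'i. euclidean :: 'a topology) UNIV)"
    using compact_space_product_topology by blast
  then show ?thesis by (simp add: euclidean_product_topology compact_space_def)
qed

context lacunary
begin

lemma continuous_digit_sum:
  assumes "\<And>k. continuous_on UNIV (\<lambda>c. \<beta> c k)"
  shows "continuous_on UNIV (\<lambda>c. digit_sum s (\<beta> c))"
proof (rule uniform_limit_theorem)
  show "uniform_limit UNIV (\<lambda>n c. \<Sum>k<n. s k * of_bool (\<beta> c k)) (\<lambda>c. digit_sum s (\<beta> c)) sequentially"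
    unfolding digit_sum_def
    by (rule Weierstrass_m_test[of _ _ s])
      (use summable_tail[of 0] pos in \<open>auto simp: of_bool_def less_imp_le\<close>)
  have "continuous_on UNIV (\<lambda>c. of_bool (\<beta> c k) :: real)" for k
    by (rule continuous_on_compose2[OF _ assms]) auto
  then show "\<forall>\<^sub>F n in sequentially. continuous_on UNIV (\<lambda>c. \<Sum>k<n. s k * of_bool (\<beta> c k))"
    by (intro always_eventually allI continuous_intros)
qed simp

lemma compact_range_code_point: "compact (range (code_point s))"
proof (rule compact_continuous_image[OF _ compact_UNIV_fun])
  have "continuous_on UNIV (\<lambda>c. x_sum s c)" "continuous_on UNIV (\<lambda>c. y_sum s c)"
    unfolding x_sum_def y_sum_def
    by (intro continuous_digit_sum continuous_intros continuous_on_product_coordinates)+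
  then have "continuous_on UNIV (\<lambda>c. code_point s c $ i)" for i
    using exhaust_2[of i] by (auto simp: code_point_def)
  from continuous_on_vec_lambda[of UNIV "\<lambda>i c. code_point s c $ i", OF this]
  show "continuous_on UNIV (code_point s)" by simp
qed

lemma dist_code_point_le:
  assumes "\<And>k. k < n \<Longrightarrow> c k = c' k"
  shows "dist (code_point s c) (code_point s c') \<le> 4 * s n"
proof -
  have "\<bar>x_sum s c - x_sum s c'\<bar> \<le> 2 * s n" "\<bar>y_sum s c - y_sum s c'\<bar> \<le> 2 * s n"
    unfolding x_sum_def y_sum_def by (intro digit_sum_close; simp add: assms)+
  then show ?thesis using dist_vector_2(2)[of "code_point s c" "code_point s c'"] by (simp add: code_point_def)
qed

lemma dist_code_point_ge:
  assumes "c n \<noteq> c' n"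
  shows "(q - 2) / (q - 1) * s n \<le> dist (code_point s c) (code_point s c')"
proof -
  consider "fst (c n) \<noteq> fst (c' n)" | "snd (c n) \<noteq> snd (c' n)" using assms by (auto simp: prod_eq_iff)
  then show ?thesis
  proof cases
    case 1
    then have "(q - 2) / (q - 1) * s n \<le> \<bar>x_sum s c - x_sum s c'\<bar>" unfolding x_sum_def by (intro digit_sum_gap)
    then show ?thesis using dist_vector_2(1)[of "code_point s c" 1 "code_point s c'"] by (simp add: code_point_def)
  next
    case 2
    then have "(q - 2) / (q - 1) * s n \<le> \<bar>y_sum s c - y_sum s c'\<bar>" unfolding y_sum_def by (intro digit_sum_gap)
    then show ?thesis using dist_vector_2(1)[of "code_point s c" 2 "code_point s c'"] by (simp add: code_point_def)
  qed
qed

lemma norm_code_point_le: "norm (code_point s c) \<le> 4 * s 0"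
  using dist_vector_2(2)[of "code_point s c" 0] digit_sum_bounds[of "\<lambda>k. fst (c k)"] digit_sum_bounds[of "\<lambda>k. snd (c k)"]
  by (simp add: code_point_def x_sum_def y_sum_def)

end

text \<open>Instead of invariance of dimension, the criterion for ranges is applied directly to
  \<open>g\<close> composed with the coding, over an alphabet of four digit pairs; \<open>g\<close>
  only changes the constants.\<close>

lemma hausdorff_dim_bi_lipschitz_range_code_point:
  fixes g :: "real^2 \<Rightarrow> real^2"
  assumes lac: "lacunary q (\<lambda>k. r ^ k)" and r: "0 < r" "r < 1"
    and h: "0 < h" "4 * r powr h = 1" and g: "bi_lipschitz g"
  shows "hausdorff_dim (g ` range (code_point (\<lambda>k. r ^ k))) = ereal h"
proof -
  interpret lacunary q "\<lambda>k. r ^ k" by (rule lac)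
  let ?P = "code_point (\<lambda>k. r ^ k)"
  obtain A B where g: "B > 0" "\<And>x y. B * dist x y \<le> dist (g x) (g y)" "\<And>x y. dist (g x) (g y) \<le> A * dist x y"
    using g unfolding bi_lipschitz_def by blast
  have card: "CARD(bool \<times> bool) = 4" by simp
  have "hausdorff_dim (range (\<lambda>c. g (?P c))) = ereal h"
  proof (rule hausdorff_dim_range[where A = "\<bar>A\<bar> * 4" and B = "B * ((q - 2) / (q - 1))" and r = r])
    fix c c' :: "nat \<Rightarrow> bool \<times> bool" and n
    assume eq: "\<And>k. k < n \<Longrightarrow> c k = c' k"
    have "dist (g (?P c)) (g (?P c')) \<le> \<bar>A\<bar> * dist (?P c) (?P c')"
      by (rule order_trans[OF g(3) mult_right_mono[OF abs_ge_self]]) simp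
    also have "\<dots> \<le> \<bar>A\<bar> * (4 * r ^ n)" using dist_code_point_le[of n c c'] eq by (intro mult_left_mono) auto
    finally show "dist (g (?P c)) (g (?P c')) \<le> \<bar>A\<bar> * 4 * r ^ n" by simp
    assume "c n \<noteq> c' n"
    from mult_left_mono[OF dist_code_point_ge[of c n c', OF this], of B] g(1) order_trans[OF _ g(2)]
    show "B * ((q - 2) / (q - 1)) * r ^ n \<le> dist (g (?P c)) (g (?P c'))" by (simp add: mult.assoc)
  qed (use g(1) q r h card in simp_all)
  then show ?thesis by (simp add: image_image)
qed

section \<open>Assembling the field\<close>

theorem theorem2p4:
  fixes h :: real
  assumes "1 < h" and "h < 2"
  shows "\<exists>(W :: real \<Rightarrow> real^2 \<Rightarrow> real^2) (S :: (real^2) set).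
    uniformly_continuous_on ({0..1} \<times> UNIV) (\<lambda>(t, x). W t x) \<and>
    weakly_div_free W \<and>
    compact S \<and> hausdorff_dim S = ereal h \<and>
    (\<exists>X. trajectory_map 1 W UNIV X \<and>
         (\<forall>Y. trajectory_map 1 W UNIV Y \<longrightarrow> (\<forall>t\<in>{0..1}. \<forall>a. Y t a = X t a)) \<and>
         (\<forall>t\<in>{0..<1}. hausdorff_dim (X t ` S) = ereal h) \<and>
         X 1 ` S = {0})"
proof -
  \<comment> \<open>The solution of \<open>4 * r powr h = 1\<close>; \<open>h < 2\<close> gives
    \<open>r < 1 / 2\<close>.\<close>
  define r :: real where "r = 4 powr (- 1 / h)"
  have r: "0 < r" "r < 1 / 2" and rh: "4 * r powr h = 1"
  proof -
    show "0 < r" by (simp add: r_def)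
    have "r < 4 powr (- 1 / 2)" unfolding r_def using assms by (intro powr_less_mono) (simp_all add: field_simps)
    also have "(4::real) powr (- 1 / 2) = 1 / 2" by (simp add: powr_minus powr_half_sqrt inverse_eq_divide)
    finally show "r < 1 / 2" .
    have "r powr h = 4 powr (- 1 / h * h)" by (simp only: r_def powr_powr)
    then show "4 * r powr h = 1" using assms by (simp add: powr_minus)
  qed
  \<comment> \<open>The midpoint between 2 and \<open>1 / r\<close>, an interval that is nonempty
    because \<open>r < 1 / 2\<close>.\<close>
  define q where "q = (2 + 1 / r) / 2"
  have q: "2 < q" "q * r < 1" using r by (simp_all add: q_def field_simps)
  define \<rho> where "\<rho> = q * r"
  have \<rho>: "0 < \<rho>" "\<rho> < 1" using q r by (simp_all add: \<rho>_def)
  let ?s = "schedule q r"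
  have lac: "lacunary q (?s m)" for m using q r by (intro lacunary_schedule) auto
  have s0: "?s 0 = (\<lambda>k. r ^ k)" by simp
  have "\<forall>m. \<exists>(F :: nat \<Rightarrow> real \<Rightarrow> real) L. (\<forall>i. (L i)-lipschitz_on UNIV (F i) \<and> (\<forall>u. \<bar>F i u\<bar> \<le> 7 * ?s m 0)) \<and>
    (\<forall>c. y_sum (?s (Suc m)) c = y_sum (?s m) c + F 0 (x_sum (?s m) c) + F 2 (x_sum (?s m) c + F 1 (y_sum (?s m) c + F 0 (x_sum (?s m) c))) \<and>
         x_sum (?s (Suc m)) c = x_sum (?s m) c + F 1 (y_sum (?s m) c + F 0 (x_sum (?s m) c)) + F 3 (y_sum (?s (Suc m)) c))"
    (is "\<forall>m. \<exists>F L. ?Q m F L")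
    using shrink_digit_by_shears[OF lac lac[of "Suc _", unfolded schedule.simps, folded \<rho>_def] \<rho>]
    unfolding schedule.simps \<rho>_def by blast
  from choice[OF this] obtain F where "\<forall>m. \<exists>L. ?Q m (F m) L" by (rule exE)
  from choice[OF this] obtain L where FL: "\<forall>m. ?Q m (F m) (L m)" by (rule exE)
  from FL have F: "\<And>m i. (L m i)-lipschitz_on UNIV (F m i)" "\<And>m i u. \<bar>F m i u\<bar> \<le> 7 * ?s m 0"
    by (simp_all only:)
  from FL have moves: "\<And>m c. y_sum (?s (Suc m)) c = y_sum (?s m) c + F m 0 (x_sum (?s m) c) + F m 2 (x_sum (?s m) c + F m 1 (y_sum (?s m) c + F m 0 (x_sum (?s m) c)))"
      "\<And>m c. x_sum (?s (Suc m)) c = x_sum (?s m) c + F m 1 (y_sum (?s m) c + F m 0 (x_sum (?s m) c)) + F m 3 (y_sum (?s (Suc m)) c)"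
    by (simp_all only:)
  \<comment> \<open>Schedule step \<open>m\<close> occupies shears \<open>4 * m\<close> to
    \<open>4 * m + 3\<close>. As 4 is even, every block begins with a vertical shear.\<close>
  define f where "f p = F (p div 4) (p mod 4)" for p
  define M where "M p = 7 * \<rho> ^ stage (p div 4)" for p
  interpret shear_flow f M "\<lambda>p. L (p div 4) (p mod 4)"
  proof
    show "summable (\<lambda>p. sqrt (M p))"
    proof -
      \<comment> \<open>The square root only replaces the ratio \<open>\<rho>\<close> by
        \<open>sqrt \<rho>\<close>, which is still below 1.\<close>
      have "summable (\<lambda>p. sqrt 7 * sqrt \<rho> ^ stage (p div 4))"
        using \<rho> by (intro summable_mult summable_div summable_power_stage) auto
      then show ?thesis by (simp add: M_def real_sqrt_mult real_sqrt_power)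
    qed
  qed (use F \<rho> in \<open>simp_all add: f_def M_def schedule_0 \<rho>_def\<close>)
  let ?P = "code_point (?s 0)"
  \<comment> \<open>Codes are preserved: after \<open>m\<close> blocks the point with code
    \<open>c\<close> has become the point with the same code for the weights of step
    \<open>m\<close>.\<close>
  have pos_4: "pos (4 * m) (?P c) = code_point (?s m) c" for m c
  proof (induction m)
    case (Suc m)
    have f4: "f (4 * m) = F m 0" "f (Suc (4 * m)) = F m 1" "f (Suc (Suc (4 * m))) = F m 2" "f (Suc (Suc (Suc (4 * m)))) = F m 3"
      by (simp_all add: f_def div_Suc mod_Suc numeral_2_eq_2 numeral_3_eq_3)
    have V: "V n x = (if even n then vector [0, f n (x $ 1)] else vector [f n (x $ 2), 0])" for n x
      by (auto simp: V_def src_def dst_def vec_eq_iff forall_2 axis_def)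
    have plus: "(vector [x, y] :: real^2) + vector [x', y'] = vector [x + x', y + y']" for x y x' y' :: real
      by (simp add: vec_eq_iff forall_2)
    have "4 * Suc m = Suc (Suc (Suc (Suc (4 * m))))" by simp
    then have "pos (4 * Suc m) (?P c) = pos (Suc (Suc (Suc (Suc (4 * m))))) (?P c)" by (simp only:)
    also have "\<dots> = code_point (?s (Suc m)) c"
      unfolding pos.simps Suc unfolding code_point_def V f4 by (simp add: plus moves del: schedule.simps)
    finally show ?case .
  qed simp
  have X1: "X 1 (?P c) = 0" for c
  proof -
    have "(\<lambda>m. pos (4 * m) (?P c)) \<longlonglongrightarrow> X 1 (?P c)"
      using LIMSEQ_subseq_LIMSEQ[OF pos_tendsto, of "\<lambda>m. 4 * m"] by (simp add: strict_mono_def o_def)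
    moreover have "(\<lambda>m. pos (4 * m) (?P c)) \<longlonglongrightarrow> 0"
    proof (rule Lim_null_comparison)
      \<comment> \<open>Leading weights are summable over the steps, hence tend to 0, and they bound
        the norms of all code points.\<close>
      have "(\<lambda>m. \<rho> ^ stage m) \<longlonglongrightarrow> 0" by (rule summable_LIMSEQ_zero[OF summable_power_stage[OF \<rho>]])
      then show "(\<lambda>m. 4 * \<rho> ^ stage m) \<longlonglongrightarrow> 0" using tendsto_mult_left[of _ 0 _ 4] by force
      show "\<forall>\<^sub>F m in sequentially. norm (pos (4 * m) (?P c)) \<le> 4 * \<rho> ^ stage m"
        using lacunary.norm_code_point_le[OF lac] by (simp add: pos_4 schedule_0 \<rho>_def del: schedule.simps)
    qed
    ultimately show ?thesis by (rule LIMSEQ_unique)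
  qed
  have dim: "hausdorff_dim (g ` range ?P) = ereal h" if "bi_lipschitz g" for g :: "real^2 \<Rightarrow> real^2"
    unfolding s0
    by (rule hausdorff_dim_bi_lipschitz_range_code_point[of q r]) (use lac[of 0] r rh that assms in \<open>simp_all add: s0\<close>)
  show ?thesis
  proof (rule exI[of _ W], rule exI[of _ "range ?P"], intro conjI exI[of _ X])
    show "uniformly_continuous_on ({0..1} \<times> UNIV) (\<lambda>(t, x). W t x)"
      using uniformly_continuous_W unfolding uniformly_continuous_on_def case_prod_unfold by blast
    show "compact (range ?P)" by (rule lacunary.compact_range_code_point[OF lac])
    show "hausdorff_dim (range ?P) = ereal h" using dim[OF bi_lipschitz_id] by simp
    show "\<forall>Y. trajectory_map 1 W UNIV Y \<longrightarrow> (\<forall>t\<in>{0..1}. \<forall>a. Y t a = X t a)"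
      using trajectory_unique by simp
    show "\<forall>t\<in>{0..<1}. hausdorff_dim (X t ` range ?P) = ereal h"
      using dim[OF bi_lipschitz_X] by simp
    show "X 1 ` range ?P = {0}" by (simp add: image_image X1 del: schedule.simps)
  qed (rule weakly_div_free_W trajectory_map_X)+
qed

end
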